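(* Let $B$ be a Hopf algebra with bijective antipode over a field $k$. Endow the Heisenberg double $\mathscr{H}(B^* )$ with its Yetter--Drinfeld $\mathscr{D}(B)$-module structure given by the left $\mathscr{D}(B)$-action $$(\mu\otimes m)\triangleright(\alpha\# a)=\mu'''(m'\rightharpoonup\alpha)\,{S^*}^{-1}(\mu'')\,\#\,\bigl((m''aS(m'''))\leftharpoonup {S^*}^{-1}(\mu')\bigr)$$ and the left $\mathscr{D}(B)$-coaction $\delta(\beta\# b)=(\beta''\otimes b')\otimes(\beta'\# b'')$. Then $\mathscr{H}(B^* )$ is braided commutative, that is, $$yx=(y_{(-1)}\triangleright x)\,y_{(0)}\qquad\text{for all }x,y\in\mathscr{H}(B^* ),$$ where $\delta(y)=y_{(-1)}\otimes y_{(0)}\in\mathscr{D}(B)\otimes\mathscr{H}(B^* )$.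
   Context: Notation. $B$ is a Hopf algebra with bijective antipode $S$ over a field $k$; $B^*$ is the dual Hopf algebra (the finite dual of $B$, which is the full linear dual when $\dim B<\infty$), with evaluation pairing $\langle\ ,\ \rangle$, product $\langle\alpha\beta,b\rangle=\langle\alpha,b'\rangle\langle\beta,b''\rangle$, coproduct determined by $\langle\beta,ab\rangle=\langle\beta',a\rangle\langle\beta'',b\rangle$, unit $\varepsilon$ (the counit of $B$), and antipode $S^*$ with inverse ${S^*}^{-1}$. Primes denote Sweedler components: $\Delta(x)=x'\otimes x''$, $(\Delta\otimes\mathrm{id})\Delta(x)=x'\otimes x''\otimes x'''$. Regular actions: $b\rightharpoonup\beta=\langle\beta'',b\rangle\beta'$ and $\beta\leftharpoonup b=\langle\beta',b\rangle\beta''$ (left and right actions of $B$ on $B^*$); $\beta\rightharpoonup b=\langle\beta,b''\rangle b'$ and $b\leftharpoonup\beta=\langle\beta,b'\rangle b''$ (left and right actions of $B^*$ on $B$). Heisenberg double: $\mathscr{H}(B^* )=B^*\# B$ is the smash product, i.e. the vector space $B^*\otimes B$ (elements written $\alpha\# a$) with product $(\alpha\# a)(\beta\# b)=\alpha(a'\rightharpoonup\beta)\# a''b$. Drinfeld double: $\mathscr{D}(B)$ is the vector space $B^*\otimes B$ with product $(\mu\otimes m)(\nu\otimes n)=\mu(m'\rightharpoonup\nu\leftharpoonup S^{-1}(m'''))\otimes m''n$, with the coalgebra structure of $B^{*\mathrm{cop}}\otimes B$, i.e. $\Delta(\mu\otimes m)=(\mu''\otimes m')\otimes(\mu'\otimes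 m'')$, and with antipode $S_{\mathscr{D}}(\mu\otimes m)=(\varepsilon\otimes S(m))({S^*}^{-1}(\mu)\otimes 1)$. The braiding in the category of left--left Yetter--Drinfeld modules over a Hopf algebra is $c_{U,V}(u\otimes v)=(u_{(-1)}\triangleright v)\otimes u_{(0)}$. *)

theory Defs
  imports Complex_Main "HOL-Library.Function_Algebras"
begin

section \<open>Tensor products of vector spaces over a field\<close>

text \<open>
  A vector space is given by a scalar multiplication on a whole type together with a subspace of
  that type.  Over a field, \<open>U \<otimes> V\<close> embeds into the dual of the space of bilinear forms on
  \<open>U \<times> V\<close>; we use its image as the model, so that \<open>u \<otimes> v\<close> is evaluation of bilinear forms at
  \<open>(u, v)\<close>.  Bilinear forms on subspaces extend to the ambient spaces, hence it is enough to
  evaluate forms defined on the whole types.  The lemma \<open>tensor_lift_sum\<close> below is the universal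
  property.
\<close>

type_synonym ('u, 'v, 'k) tensor = "('u \<Rightarrow> 'v \<Rightarrow> 'k) \<Rightarrow> 'k"

definition fscale :: "'k::times \<Rightarrow> ('a \<Rightarrow> 'k) \<Rightarrow> 'a \<Rightarrow> 'k"
  where "fscale c f = (\<lambda>x. c * f x)"

definition bilinear_form ::
  "('k::field \<Rightarrow> 'u::ab_group_add \<Rightarrow> 'u) \<Rightarrow> ('k \<Rightarrow> 'v::ab_group_add \<Rightarrow> 'v) \<Rightarrow> ('u \<Rightarrow> 'v \<Rightarrow> 'k) \<Rightarrow> bool"
  where "bilinear_form sU sV f \<longleftrightarrow>
    (\<forall>u. Vector_Spaces.linear sV (*) (\<lambda>v. f u v)) \<and> (\<forall>v. Vector_Spaces.linear sU (*) (\<lambda>u. f u v))"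

definition pure_tensor ::
  "('k::field \<Rightarrow> 'u::ab_group_add \<Rightarrow> 'u) \<Rightarrow> ('k \<Rightarrow> 'v::ab_group_add \<Rightarrow> 'v) \<Rightarrow> 'u \<Rightarrow> 'v \<Rightarrow> ('u, 'v, 'k) tensor"
  where "pure_tensor sU sV u v = (\<lambda>f. if bilinear_form sU sV f then f u v else 0)"

definition tensor_space ::
  "('k::field \<Rightarrow> 'u::ab_group_add \<Rightarrow> 'u) \<Rightarrow> ('k \<Rightarrow> 'v::ab_group_add \<Rightarrow> 'v) \<Rightarrow> 'u set \<Rightarrow> 'v set
    \<Rightarrow> ('u, 'v, 'k) tensor set"
  where "tensor_space sU sV U V =
    {t. \<exists>xs. set xs \<subseteq> U \<times> V \<and> t = (\<Sum>(u, v)\<leftarrow>xs. pure_tensor sU sV u v)}"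

text \<open>
  The value at \<open>t \<in> U \<otimes> V\<close> of the linear map induced by a map \<open>f\<close> that is bilinear on \<open>U \<times> V\<close>:
  if \<open>t = \<Sum>\<^sub>i u\<^sub>i \<otimes> v\<^sub>i\<close>, this is \<open>\<Sum>\<^sub>i f u\<^sub>i v\<^sub>i\<close>, whichever decomposition is chosen.
\<close>

definition tensor_lift ::
  "('k::field \<Rightarrow> 'u::ab_group_add \<Rightarrow> 'u) \<Rightarrow> ('k \<Rightarrow> 'v::ab_group_add \<Rightarrow> 'v) \<Rightarrow> 'u set \<Rightarrow> 'v set
    \<Rightarrow> ('u, 'v, 'k) tensor \<Rightarrow> ('u \<Rightarrow> 'v \<Rightarrow> 'w::ab_group_add) \<Rightarrow> 'w"
  where "tensor_lift sU sV U V t f =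
    (let xs = SOME xs. set xs \<subseteq> U \<times> V \<and> t = (\<Sum>(u, v)\<leftarrow>xs. pure_tensor sU sV u v)
     in \<Sum>(u, v)\<leftarrow>xs. f u v)"

lemma sum_list_fun_apply:
  fixes g :: "'c \<Rightarrow> 'd \<Rightarrow> 'e::monoid_add"
  shows "(\<Sum>x\<leftarrow>xs. g x) y = (\<Sum>x\<leftarrow>xs. g x y)"
  by (induction xs) auto

lemma vector_space_field: "vector_space ((*) :: 'k::field \<Rightarrow> 'k \<Rightarrow> 'k)"
  by unfold_locales (auto simp: algebra_simps)

lemma tensor_lift_sum:
  fixes sW :: "'k::field \<Rightarrow> 'w::ab_group_add \<Rightarrow> 'w"
    and sU :: "'k \<Rightarrow> 'u::ab_group_add \<Rightarrow> 'u" and sV :: "'k \<Rightarrow> 'v::ab_group_add \<Rightarrow> 'v"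
  assumes "vector_space sU" "vector_space sV" "vector_space sW"
    and U: "module.subspace sU U" and V: "module.subspace sV V"
    and add_left: "\<And>u1 u2 v. \<lbrakk>u1 \<in> U; u2 \<in> U; v \<in> V\<rbrakk> \<Longrightarrow> f (u1 + u2) v = f u1 v + f u2 v"
    and add_right: "\<And>u v1 v2. \<lbrakk>u \<in> U; v1 \<in> V; v2 \<in> V\<rbrakk> \<Longrightarrow> f u (v1 + v2) = f u v1 + f u v2"
    and scale_left: "\<And>c u v. \<lbrakk>u \<in> U; v \<in> V\<rbrakk> \<Longrightarrow> f (sU c u) v = sW c (f u v)"
    and scale_right: "\<And>c u v. \<lbrakk>u \<in> U; v \<in> V\<rbrakk> \<Longrightarrow> f u (sV c v) = sW c (f u v)"
    and xs: "set xs \<subseteq> U \<times> V"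
  shows "tensor_lift sU sV U V (\<Sum>(u, v)\<leftarrow>xs. pure_tensor sU sV u v) f = (\<Sum>(u, v)\<leftarrow>xs. f u v)"
proof -
  let ?t = "\<lambda>ys. \<Sum>(u, v)\<leftarrow>ys. pure_tensor sU sV u v"
  let ?F = "\<lambda>ys. \<Sum>(u, v)\<leftarrow>ys. f u v"
  interpret U: vector_space sU by fact
  interpret V: vector_space sV by fact
  interpret W: vector_space sW by fact
  interpret K: vector_space "(*) :: 'k \<Rightarrow> 'k \<Rightarrow> 'k" by (rule vector_space_field)
  interpret WK: vector_space_pair sW "(*) :: 'k \<Rightarrow> 'k \<Rightarrow> 'k" ..
  interpret UU: vector_space_pair sU sU ..
  interpret VV: vector_space_pair sV sV ..
  have eq: "?F ys = ?F xs" if ys: "set ys \<subseteq> U \<times> V" and t: "?t ys = ?t xs" for ys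
  proof (rule ccontr)
    assume "?F ys \<noteq> ?F xs"
    then have "W.independent {?F ys - ?F xs}"
      by simp
    from WK.linear_independent_extend[OF this, of "\<lambda>_. 1"] obtain \<phi>
      where \<phi>: "Vector_Spaces.linear sW (*) \<phi>" "\<phi> (?F ys - ?F xs) = 1" by auto
    interpret \<phi>: Vector_Spaces.linear sW "(*)" \<phi> by fact
    have "Vector_Spaces.linear sU sU (\<lambda>x. x)" by (rule U.linear_ident)
    from UU.linear_exists_left_inverse_on[OF this U] obtain p
      where p: "range p \<subseteq> U" "Vector_Spaces.linear sU sU p" "\<And>u. u \<in> U \<Longrightarrow> p u = u" by auto
    have "Vector_Spaces.linear sV sV (\<lambda>x. x)" by (rule V.linear_ident)
    from VV.linear_exists_left_inverse_on[OF this V] obtain q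
      where q: "range q \<subseteq> V" "Vector_Spaces.linear sV sV q" "\<And>v. v \<in> V \<Longrightarrow> q v = v" by auto
    interpret p: Vector_Spaces.linear sU sU p by fact
    interpret q: Vector_Spaces.linear sV sV q by fact
    define g where "g = (\<lambda>u v. \<phi> (f (p u) (q v)))"
    have p': "p u \<in> U" and q': "q v \<in> V" for u v
      using p(1) q(1) by auto
    have g: "bilinear_form sU sV g"
      unfolding bilinear_form_def g_def
      by (auto simp: Vector_Spaces.linear_def module_hom_def module_hom_axioms_def U.vector_space_axioms
          V.vector_space_axioms K.vector_space_axioms U.module_axioms V.module_axioms K.module_axioms
          p.add q.add p.scale q.scale \<phi>.add \<phi>.scale p' q' add_left add_right scale_left scale_right)
    have val: "?t zs g = \<phi> (?F zs)" if "set zs \<subseteq> U \<times> V" for zs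
      using that
    proof (induction zs)
      case Nil
      then show ?case by (simp add: \<phi>.zero)
    next
      case (Cons z zs)
      then show ?case
        using g by (cases z) (auto simp: pure_tensor_def g_def p q \<phi>.add)
    qed
    have "\<phi> (?F ys) = \<phi> (?F xs)"
      using val[OF ys] val[OF xs] t by simp
    with \<phi>(2) show False by (simp add: \<phi>.diff)
  qed
  define ys where "ys = (SOME ys. set ys \<subseteq> U \<times> V \<and> ?t xs = ?t ys)"
  have "set ys \<subseteq> U \<times> V \<and> ?t xs = ?t ys"
    unfolding ys_def by (rule someI[of _ xs]) (use xs in auto)
  then have "?F ys = ?F xs" by (intro eq) auto
  then show ?thesis by (simp add: tensor_lift_def Let_def ys_def)
qed


section \<open>Algebras and the coalgebra structure of the finite dual\<close>

locale unital_algebra = vector_space scale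
  for scale :: "'k::field \<Rightarrow> 'b::ring_1 \<Rightarrow> 'b" +
  assumes scale_mult_left: "scale c x * y = scale c (x * y)"
    and scale_mult_right: "x * scale c y = scale c (x * y)"
begin

definition two_sided_ideal :: "'b set \<Rightarrow> bool"
  where "two_sided_ideal I \<longleftrightarrow> subspace I \<and> (\<forall>x\<in>I. \<forall>b. b * x \<in> I \<and> x * b \<in> I)"

definition finite_codimension :: "'b set \<Rightarrow> bool"
  where "finite_codimension I \<longleftrightarrow> (\<exists>F. finite F \<and> span (I \<union> F) = UNIV)"

definition fdual :: "('b \<Rightarrow> 'k) set"
  where "fdual = {\<beta>. Vector_Spaces.linear scale (*) \<beta> \<and>
    (\<exists>I. two_sided_ideal I \<and> finite_codimension I \<and> (\<forall>x\<in>I. \<beta> x = 0))}"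

definition dual_comult :: "('b \<Rightarrow> 'k) \<Rightarrow> ('b \<Rightarrow> 'k, 'b \<Rightarrow> 'k, 'k) tensor"
  where "dual_comult \<beta> = (THE t. t \<in> tensor_space fscale fscale fdual fdual \<and>
    (\<forall>a b. \<beta> (a * b) = tensor_lift fscale fscale fdual fdual t (\<lambda>\<beta>' \<beta>''. \<beta>' a * \<beta>'' b)))"

text \<open>
  Sweedler notation: \<open>dual_sweedler \<beta> (\<lambda>\<beta>' \<beta>''. F \<beta>' \<beta>'')\<close> is the sum written \<open>F \<beta>' \<beta>''\<close> on paper, and
  the variant with three components is taken along \<open>(\<Delta> \<otimes> id) \<circ> \<Delta>\<close>.
\<close>

definition dual_sweedler ::
  "('b \<Rightarrow> 'k) \<Rightarrow> (('b \<Rightarrow> 'k) \<Rightarrow> ('b \<Rightarrow> 'k) \<Rightarrow> 'w::ab_group_add) \<Rightarrow> 'w"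
  where "dual_sweedler \<beta> F = tensor_lift fscale fscale fdual fdual (dual_comult \<beta>) F"

definition dual_sweedler3 ::
  "('b \<Rightarrow> 'k) \<Rightarrow> (('b \<Rightarrow> 'k) \<Rightarrow> ('b \<Rightarrow> 'k) \<Rightarrow> ('b \<Rightarrow> 'k) \<Rightarrow> 'w::ab_group_add) \<Rightarrow> 'w"
  where "dual_sweedler3 \<beta> F = dual_sweedler \<beta> (\<lambda>\<gamma> \<beta>'''. dual_sweedler \<gamma> (\<lambda>\<beta>' \<beta>''. F \<beta>' \<beta>'' \<beta>'''))"

definition act_on_dual :: "'b \<Rightarrow> ('b \<Rightarrow> 'k) \<Rightarrow> ('b \<Rightarrow> 'k)"  (infixr \<open>\<rightharpoonup>\<close> 75)
  where "b \<rightharpoonup> \<beta> = dual_sweedler \<beta> (\<lambda>\<beta>' \<beta>''. fscale (\<beta>'' b) \<beta>')"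

end


section \<open>Hopf algebras\<close>

locale hopf_algebra = unital_algebra scale
  for scale :: "'k::field \<Rightarrow> 'b::ring_1 \<Rightarrow> 'b" +
  fixes comult :: "'b \<Rightarrow> ('b, 'b, 'k) tensor"
    and counit :: "'b \<Rightarrow> 'k"
    and antipode :: "'b \<Rightarrow> 'b"
  assumes comult_in: "comult b \<in> tensor_space scale scale UNIV UNIV"
    and comult_linear: "Vector_Spaces.linear scale fscale comult"
    and counit_linear: "Vector_Spaces.linear scale (*) counit"
    and antipode_linear: "Vector_Spaces.linear scale scale antipode"
    and coassoc:
      "tensor_lift scale scale UNIV UNIV (comult b) (\<lambda>x y.
         tensor_lift scale scale UNIV UNIV (comult x) (\<lambda>x' x''.
           pure_tensor fscale scale (pure_tensor scale scale x' x'') y)) =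
       tensor_lift scale scale UNIV UNIV (comult b) (\<lambda>x y.
         tensor_lift scale scale UNIV UNIV (comult y) (\<lambda>y' y''.
           pure_tensor fscale scale (pure_tensor scale scale x y') y''))"
    and counit_left:
      "tensor_lift scale scale UNIV UNIV (comult b) (\<lambda>b' b''. scale (counit b') b'') = b"
    and counit_right:
      "tensor_lift scale scale UNIV UNIV (comult b) (\<lambda>b' b''. scale (counit b'') b') = b"
    and comult_mult:
      "comult (a * b) =
       tensor_lift scale scale UNIV UNIV (comult a) (\<lambda>a' a''.
         tensor_lift scale scale UNIV UNIV (comult b) (\<lambda>b' b''.
           pure_tensor scale scale (a' * b') (a'' * b'')))"
    and comult_one: "comult 1 = pure_tensor scale scale 1 1"
    and counit_mult: "counit (a * b) = counit a * counit b"
    and counit_one: "counit 1 = 1"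
    and antipode_left:
      "tensor_lift scale scale UNIV UNIV (comult b) (\<lambda>b' b''. antipode b' * b'') = scale (counit b) 1"
    and antipode_right:
      "tensor_lift scale scale UNIV UNIV (comult b) (\<lambda>b' b''. b' * antipode b'') = scale (counit b) 1"
begin

definition sweedler :: "'b \<Rightarrow> ('b \<Rightarrow> 'b \<Rightarrow> 'w::ab_group_add) \<Rightarrow> 'w"
  where "sweedler b F = tensor_lift scale scale UNIV UNIV (comult b) F"

definition sweedler3 :: "'b \<Rightarrow> ('b \<Rightarrow> 'b \<Rightarrow> 'b \<Rightarrow> 'w::ab_group_add) \<Rightarrow> 'w"
  where "sweedler3 b F = sweedler b (\<lambda>c b'''. sweedler c (\<lambda>b' b''. F b' b'' b'''))"

definition dual_mult :: "('b \<Rightarrow> 'k) \<Rightarrow> ('b \<Rightarrow> 'k) \<Rightarrow> ('b \<Rightarrow> 'k)"  (infixl \<open>\<star>\<close> 70)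
  where "\<alpha> \<star> \<beta> = (\<lambda>b. sweedler b (\<lambda>b' b''. \<alpha> b' * \<beta> b''))"

definition dual_antipode :: "('b \<Rightarrow> 'k) \<Rightarrow> ('b \<Rightarrow> 'k)"
  where "dual_antipode \<beta> = (\<lambda>b. \<beta> (antipode b))"

definition dual_antipode_inv :: "('b \<Rightarrow> 'k) \<Rightarrow> ('b \<Rightarrow> 'k)"
  where "dual_antipode_inv = inv_into fdual dual_antipode"

definition dual_acts_right :: "'b \<Rightarrow> ('b \<Rightarrow> 'k) \<Rightarrow> 'b"  (infixl \<open>\<leftharpoonup>\<close> 75)
  where "b \<leftharpoonup> \<beta> = sweedler b (\<lambda>b' b''. scale (\<beta> b') b'')"


section \<open>The Heisenberg double and the Drinfeld double action and coaction\<close>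

text \<open>
  \<open>B\<^sup>* \<otimes> B\<close> is the space underlying both the Heisenberg double and the Drinfeld double; the algebra
  structure of the latter is not involved in braided commutativity.
\<close>

type_synonym (in -) ('k, 'b) double = "('b \<Rightarrow> 'k, 'b, 'k) tensor"

definition double_space :: "('k, 'b) double set"
  where "double_space = tensor_space fscale scale fdual UNIV"

definition smash :: "('b \<Rightarrow> 'k) \<Rightarrow> 'b \<Rightarrow> ('k, 'b) double"  (infix \<open>\<sharp>\<close> 60)
  where "\<alpha> \<sharp> a = pure_tensor fscale scale \<alpha> a"

definition double_lift :: "('k, 'b) double \<Rightarrow> (('b \<Rightarrow> 'k) \<Rightarrow> 'b \<Rightarrow> 'w::ab_group_add) \<Rightarrow> 'w"
  where "double_lift x F = tensor_lift fscale scale fdual UNIV x F"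

definition heisenberg_mult :: "('k, 'b) double \<Rightarrow> ('k, 'b) double \<Rightarrow> ('k, 'b) double"
  where "heisenberg_mult x y =
    double_lift x (\<lambda>\<alpha> a. double_lift y (\<lambda>\<beta> b.
      sweedler a (\<lambda>a' a''. (\<alpha> \<star> (a' \<rightharpoonup> \<beta>)) \<sharp> (a'' * b))))"

definition drinfeld_action :: "('k, 'b) double \<Rightarrow> ('k, 'b) double \<Rightarrow> ('k, 'b) double"
  where "drinfeld_action d x =
    double_lift d (\<lambda>\<mu> m. double_lift x (\<lambda>\<alpha> a.
      dual_sweedler3 \<mu> (\<lambda>\<mu>' \<mu>'' \<mu>'''. sweedler3 m (\<lambda>m' m'' m'''.
        (\<mu>''' \<star> (m' \<rightharpoonup> \<alpha>) \<star> dual_antipode_inv \<mu>'') \<sharp>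
        ((m'' * a * antipode m''') \<leftharpoonup> dual_antipode_inv \<mu>')))))"

definition drinfeld_coaction :: "('k, 'b) double \<Rightarrow> (('k, 'b) double, ('k, 'b) double, 'k) tensor"
  where "drinfeld_coaction y =
    double_lift y (\<lambda>\<beta> b.
      dual_sweedler \<beta> (\<lambda>\<beta>' \<beta>''. sweedler b (\<lambda>b' b''.
        pure_tensor fscale fscale (\<beta>'' \<sharp> b') (\<beta>' \<sharp> b''))))"

end

text \<open>
  \<open>A\<close> carries a product, an action of \<open>D\<close> and a coaction with values in \<open>D \<otimes> A\<close>; the right-hand side
  is the product composed with the Yetter--Drinfeld braiding, applied to \<open>y \<otimes> x\<close>.
\<close>

definition braided_commutative ::
  "('k::field \<Rightarrow> 'd::ab_group_add \<Rightarrow> 'd) \<Rightarrow> 'd set \<Rightarrow> ('k \<Rightarrow> 'a::ab_group_add \<Rightarrow> 'a) \<Rightarrow> 'a set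
    \<Rightarrow> ('a \<Rightarrow> 'a \<Rightarrow> 'a) \<Rightarrow> ('d \<Rightarrow> 'a \<Rightarrow> 'a) \<Rightarrow> ('a \<Rightarrow> ('d, 'a, 'k) tensor) \<Rightarrow> bool"
  where "braided_commutative sD D sA A mult act coact \<longleftrightarrow>
    (\<forall>x\<in>A. \<forall>y\<in>A. mult y x = tensor_lift sD sA D A (coact y) (\<lambda>d a. mult (act d x) a))"

end

theory Submission
  imports Defs
begin

text \<open>
  By linearity take \<open>y = \<beta> # b\<close> and \<open>x = \<alpha> # a\<close>. Writing out \<open>(y\<^sub>-\<^sub>1 \<triangleright> x) y\<^sub>0\<close> with \<open>e = b'' a S(b''')\<close>, the
  component of \<open>\<beta>\<close> paired with \<open>S\<^sup>-\<^sup>1\<close> of the first factor of \<open>e\<close> meets the component acted upon by the second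
  factor, and \<open>e'' S\<^sup>-\<^sup>1(e') = \<epsilon>(e) 1\<close> removes both. Then \<open>S\<^sup>*\<^sup>-\<^sup>1(\<beta>'') \<beta>' = \<langle>\<beta>, 1\<rangle> \<epsilon>\<close> removes the next pair
  of components, and \<open>S(b''') b'''' = \<epsilon>(b''') 1\<close> leaves \<open>\<beta> (b' \<rightharpoonup> \<alpha>) # b'' a = y x\<close>.
  Coassociativity of the finite dual and the existence and uniqueness of its coproduct come from a
  dual basis of the quotient by an ideal of finite codimension.
\<close>


section \<open>Linear maps on subspaces and on tensor products\<close>

text \<open>
  Induction rules leave terms of function type eta-expanded, and the simplifier would then apply
  the pointwise rules below the abstraction.
\<close>

declare plus_fun_apply [simp del] zero_fun_apply [simp del]

text \<open>A Sweedler sum is encoded as a sum over one arbitrarily chosen decomposition of a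
  tensor. Exchanging two independent sums is free, but regrouping by coassociativity, or passing to
  another decomposition, is justified only when the summand is linear in each component. Hence the
  linearity calculus that fills much of the development. Linearity is taken relative to subsets
  because the finite dual is in general a proper subspace of \<open>'b \<Rightarrow> 'k\<close>, and
  \<open>dual_sweedler\<close> need not be additive outside it. The free exchange also separates the
  two halves of the computation: with the components of b held fixed, all four components of \<beta>
  are summed away, and only then is b touched. Both cancellations on the dual side rest on one
  identity, \<open>sweedler_antipode_inv\<close>, which is where bijectivity of the antipode enters;
  bijectivity is also what turns the inverse of \<open>dual_antipode\<close> into precomposition
  with \<open>inv antipode\<close>.\<close>

definition lin_on ::
  "('k \<Rightarrow> 'u::ab_group_add \<Rightarrow> 'u) \<Rightarrow> ('k \<Rightarrow> 'w::ab_group_add \<Rightarrow> 'w) \<Rightarrow> 'u set \<Rightarrow> ('u \<Rightarrow> 'w) \<Rightarrow> bool"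
  where "lin_on sU sW U g \<longleftrightarrow>
    (\<forall>x\<in>U. \<forall>y\<in>U. g (x + y) = g x + g y) \<and> (\<forall>c. \<forall>x\<in>U. g (sU c x) = sW c (g x))"

definition bilin_on ::
  "('k \<Rightarrow> 'u::ab_group_add \<Rightarrow> 'u) \<Rightarrow> ('k \<Rightarrow> 'v::ab_group_add \<Rightarrow> 'v) \<Rightarrow> ('k \<Rightarrow> 'w::ab_group_add \<Rightarrow> 'w)
    \<Rightarrow> 'u set \<Rightarrow> 'v set \<Rightarrow> ('u \<Rightarrow> 'v \<Rightarrow> 'w) \<Rightarrow> bool"
  where "bilin_on sU sV sW U V f \<longleftrightarrow>
    (\<forall>v\<in>V. lin_on sU sW U (\<lambda>u. f u v)) \<and> (\<forall>u\<in>U. lin_on sV sW V (f u))"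

lemma lin_onI:
  "\<lbrakk>\<And>x y. \<lbrakk>x \<in> U; y \<in> U\<rbrakk> \<Longrightarrow> g (x + y) = g x + g y; \<And>c x. x \<in> U \<Longrightarrow> g (sU c x) = sW c (g x)\<rbrakk>
    \<Longrightarrow> lin_on sU sW U g"
  by (simp add: lin_on_def)

lemma bilin_onI:
  "\<lbrakk>\<And>v. v \<in> V \<Longrightarrow> lin_on sU sW U (\<lambda>u. f u v); \<And>u. u \<in> U \<Longrightarrow> lin_on sV sW V (\<lambda>v. f u v)\<rbrakk>
    \<Longrightarrow> bilin_on sU sV sW U V f"
  by (simp add: bilin_on_def)

lemma lin_on_add: "\<lbrakk>lin_on sU sW U g; x \<in> U; y \<in> U\<rbrakk> \<Longrightarrow> g (x + y) = g x + g y"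
  and lin_on_scale: "\<lbrakk>lin_on sU sW U g; x \<in> U\<rbrakk> \<Longrightarrow> g (sU c x) = sW c (g x)"
  by (simp_all add: lin_on_def)

text \<open>A subspace is closed under the two operations, so \<open>f\<close> and \<open>g\<close>
  also agree at \<open>x + y\<close> and \<open>sU c x\<close>. Structure maps defined with
  \<open>act_on_dual\<close> or \<open>dual_antipode_inv\<close> get their workable formulas only on
  \<open>double_space\<close>, and linearity is transported from these.\<close>

lemma lin_on_cong:
  assumes "module.subspace sU U" "vector_space sU" "\<And>x. x \<in> U \<Longrightarrow> f x = g x" "lin_on sU sW U g"
  shows "lin_on sU sW U f"
proof -
  interpret vector_space sU by fact
  show ?thesis
    using assms by (auto simp: lin_on_def subspace_add subspace_scale)
qed

lemma lin_on_compose: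
  "\<lbrakk>lin_on sV sW V h; lin_on sU sV U g; \<And>x. x \<in> U \<Longrightarrow> g x \<in> V\<rbrakk> \<Longrightarrow> lin_on sU sW U (\<lambda>x. h (g x))"
  by (simp add: lin_on_def)

lemma fscale_apply: "fscale c f x = c * f x"
  by (simp add: fscale_def)

lemmas fun_simps = fscale_apply plus_fun_apply zero_fun_apply

lemma vector_space_fscale [simp]: "vector_space (fscale :: 'k::field \<Rightarrow> ('a \<Rightarrow> 'k) \<Rightarrow> 'a \<Rightarrow> 'k)"
  by unfold_locales (auto simp: fun_eq_iff fun_simps algebra_simps)

lemma fscale_add: "fscale c (f + g) = fscale c f + fscale (c :: 'k::field) g"
  and fscale_add_left: "fscale (c + d) f = fscale c f + fscale d f"
  and fscale_0: "fscale c 0 = 0"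
  and fscale_fscale: "fscale c (fscale d f) = fscale (c * d) f"
  by (auto simp: fun_eq_iff fun_simps algebra_simps)

lemma bilinear_form_iff:
  fixes sU :: "'k::field \<Rightarrow> 'u::ab_group_add \<Rightarrow> 'u" and sV :: "'k \<Rightarrow> 'v::ab_group_add \<Rightarrow> 'v"
  assumes "vector_space sU" "vector_space sV"
  shows "bilinear_form sU sV f \<longleftrightarrow> bilin_on sU sV (*) UNIV UNIV f"
proof -
  interpret U: vector_space sU by fact
  interpret V: vector_space sV by fact
  interpret K: vector_space "(*) :: 'k \<Rightarrow> 'k \<Rightarrow> 'k" by (rule vector_space_field)
  show ?thesis
    by (auto simp: bilinear_form_def bilin_on_def lin_on_def Vector_Spaces.linear_def module_hom_def
        module_hom_axioms_def U.vector_space_axioms V.vector_space_axioms K.vector_space_axioms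
        U.module_axioms V.module_axioms K.module_axioms)
qed

lemma linear_iff_lin_on:
  fixes sU :: "'k::field \<Rightarrow> 'u::ab_group_add \<Rightarrow> 'u" and sV :: "'k \<Rightarrow> 'v::ab_group_add \<Rightarrow> 'v"
  assumes "vector_space sU" "vector_space sV"
  shows "Vector_Spaces.linear sU sV f \<longleftrightarrow> lin_on sU sV UNIV f"
proof -
  interpret U: vector_space sU by fact
  interpret V: vector_space sV by fact
  show ?thesis
    by (auto simp: lin_on_def Vector_Spaces.linear_def module_hom_def
        module_hom_axioms_def U.vector_space_axioms V.vector_space_axioms
        U.module_axioms V.module_axioms)
qed

text \<open>
  The decomposition that \<^const>\<open>tensor_lift\<close> chooses depends on the tensor only, so the lift is a
  finite sum over a fixed list, and the rules for sums hold for it without any bilinearity.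
\<close>

definition tensor_decomp where
  "tensor_decomp sU sV U V t =
    (SOME xs. set xs \<subseteq> U \<times> V \<and> t = (\<Sum>(u, v)\<leftarrow>xs. pure_tensor sU sV u v))"

lemma tensor_lift_decomp: "tensor_lift sU sV U V t f = (\<Sum>(u, v)\<leftarrow>tensor_decomp sU sV U V t. f u v)"
  by (simp add: tensor_lift_def tensor_decomp_def)

lemma tensor_decomp:
  assumes "t \<in> tensor_space sU sV U V"
  shows "set (tensor_decomp sU sV U V t) \<subseteq> U \<times> V"
    and "(\<Sum>(u, v)\<leftarrow>tensor_decomp sU sV U V t. pure_tensor sU sV u v) = t"
proof -
  have "\<exists>xs. set xs \<subseteq> U \<times> V \<and> t = (\<Sum>(u, v)\<leftarrow>xs. pure_tensor sU sV u v)"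
    using assms by (simp add: tensor_space_def)
  from someI_ex[OF this]
  show "set (tensor_decomp sU sV U V t) \<subseteq> U \<times> V"
    and "(\<Sum>(u, v)\<leftarrow>tensor_decomp sU sV U V t. pure_tensor sU sV u v) = t"
    by (simp_all add: tensor_decomp_def)
qed

lemma tensor_lift_cong:
  assumes "t \<in> tensor_space sU sV U V" "\<And>u v. \<lbrakk>u \<in> U; v \<in> V\<rbrakk> \<Longrightarrow> f u v = g u v"
  shows "tensor_lift sU sV U V t f = tensor_lift sU sV U V t g"
  unfolding tensor_lift_decomp
  using tensor_decomp(1)[OF assms(1)] assms(2) by (intro arg_cong[of _ _ sum_list] map_cong) auto

lemma sum_list_hom:
  assumes "h 0 = 0" "\<And>x y. h (x + y) = h x + h y"
  shows "h (\<Sum>x\<leftarrow>xs. f x) = (\<Sum>x\<leftarrow>xs. h (f x))"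
  by (induction xs) (auto simp: assms)

lemma tensor_lift_hom:
  fixes h :: "'w::ab_group_add \<Rightarrow> 'x::ab_group_add"
  assumes "\<And>x y. h (x + y) = h x + h y"
  shows "h (tensor_lift sU sV U V t f) = tensor_lift sU sV U V t (\<lambda>u v. h (f u v))"
proof -
  have "h 0 = 0" using assms[of 0 0] by simp
  then show ?thesis
    unfolding tensor_lift_decomp by (subst sum_list_hom) (auto simp: assms case_prod_unfold)
qed

lemma tensor_lift_mem:
  assumes "module.subspace sW W" "vector_space sW" "t \<in> tensor_space sU sV U V"
    "\<And>u v. \<lbrakk>u \<in> U; v \<in> V\<rbrakk> \<Longrightarrow> f u v \<in> W"
  shows "tensor_lift sU sV U V t f \<in> W"
proof -
  interpret vector_space sW by fact
  have "(\<Sum>(u, v)\<leftarrow>xs. f u v) \<in> W" if "set xs \<subseteq> U \<times> V" for xs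
    using that by (induction xs) (auto simp: subspace_add subspace_0 assms)
  then show ?thesis
    using tensor_decomp(1)[OF assms(3)] by (simp add: tensor_lift_decomp)
qed

text \<open>For maps that are linear only on a subspace, such as a lift on a tensor space or a
  product on \<open>double_space\<close>. The partial sums must stay in \<open>W\<close>, so the
  induction carries membership along with the equation.\<close>

lemma tensor_lift_lin_hom:
  assumes W: "module.subspace sW W" "vector_space sW" and "vector_space sX" and t: "t \<in> tensor_space sU sV U V"
    and f: "\<And>u v. \<lbrakk>u \<in> U; v \<in> V\<rbrakk> \<Longrightarrow> f u v \<in> W" and h: "lin_on sW sX W h"
  shows "h (tensor_lift sU sV U V t f) = tensor_lift sU sV U V t (\<lambda>u v. h (f u v))"
proof -
  interpret vector_space sW by fact
  interpret X: vector_space sX by fact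
  have "h 0 = sX 0 (h 0)"
    using lin_on_scale[OF h subspace_0[OF W(1)], of 0] by simp
  then have h0: "h 0 = 0" by simp
  have "h (\<Sum>(u, v)\<leftarrow>xs. f u v) = (\<Sum>(u, v)\<leftarrow>xs. h (f u v)) \<and> (\<Sum>(u, v)\<leftarrow>xs. f u v) \<in> W"
    if "set xs \<subseteq> U \<times> V" for xs
    using that
    by (induction xs) (auto simp: h0 lin_on_add[OF h] f subspace_add[OF W(1)] subspace_0[OF W(1)])
  then show ?thesis
    using tensor_decomp(1)[OF t] by (simp add: tensor_lift_decomp)
qed

lemma tensor_lift_add_fun:
  "tensor_lift sU sV U V t (\<lambda>u v. f u v + g u v) = tensor_lift sU sV U V t f + tensor_lift sU sV U V t g"
  by (simp add: tensor_lift_decomp case_prod_unfold sum_list_addf)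

lemma tensor_lift_scale_fun:
  assumes "vector_space sW"
  shows "tensor_lift sU sV U V t (\<lambda>u v. sW c (f u v)) = sW c (tensor_lift sU sV U V t f)"
proof -
  interpret vector_space sW by fact
  show ?thesis
    by (subst tensor_lift_hom[of "sW c"]) (auto simp: scale_right_distrib)
qed

lemma tensor_lift_apply:
  "tensor_lift sU sV U V t f x = tensor_lift sU sV U V t (\<lambda>u v. f u v x)"
  by (simp add: tensor_lift_decomp sum_list_fun_apply case_prod_unfold)

lemma tensor_lift_swap:
  "tensor_lift sU sV U V t (\<lambda>u v. tensor_lift sX sY X Y s (\<lambda>x y. f u v x y)) =
   tensor_lift sX sY X Y s (\<lambda>x y. tensor_lift sU sV U V t (\<lambda>u v. f u v x y))"
proof -
  have "(\<Sum>(u, v)\<leftarrow>us. \<Sum>(x, y)\<leftarrow>xs. f u v x y) = (\<Sum>(x, y)\<leftarrow>xs. \<Sum>(u, v)\<leftarrow>us. f u v x y)" for us xs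
    by (induction us) (auto simp: sum_list_addf case_prod_unfold)
  then show ?thesis by (simp add: tensor_lift_decomp)
qed

lemma lin_on_tensor_lift_fun:
  assumes "t \<in> tensor_space sU sV U V" "vector_space sW"
    "\<And>u v. \<lbrakk>u \<in> U; v \<in> V\<rbrakk> \<Longrightarrow> lin_on sX sW X (\<lambda>x. f x u v)"
  shows "lin_on sX sW X (\<lambda>x. tensor_lift sU sV U V t (f x))"
proof (rule lin_onI)
  fix x y assume "x \<in> X" "y \<in> X"
  then have "tensor_lift sU sV U V t (f (x + y)) = tensor_lift sU sV U V t (\<lambda>u v. f x u v + f y u v)"
    by (intro tensor_lift_cong assms) (use assms(3) lin_on_add in fastforce)
  then show "tensor_lift sU sV U V t (f (x + y)) = tensor_lift sU sV U V t (f x) + tensor_lift sU sV U V t (f y)"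
    by (simp add: tensor_lift_add_fun)
next
  fix c x assume "x \<in> X"
  then have "tensor_lift sU sV U V t (f (sX c x)) = tensor_lift sU sV U V t (\<lambda>u v. sW c (f x u v))"
    by (intro tensor_lift_cong assms) (use assms(3) lin_on_scale in fastforce)
  then show "tensor_lift sU sV U V t (f (sX c x)) = sW c (tensor_lift sU sV U V t (f x))"
    by (simp add: tensor_lift_scale_fun assms)
qed

section \<open>Tensor products of two subspaces\<close>

locale tensor_factors =
  fixes sU :: "'k::field \<Rightarrow> 'u::ab_group_add \<Rightarrow> 'u" and sV :: "'k \<Rightarrow> 'v::ab_group_add \<Rightarrow> 'v"
    and U V
  assumes vs: "vector_space sU" "vector_space sV"
    and sub: "module.subspace sU U" "module.subspace sV V"
begin

interpretation U: vector_space sU by (rule vs)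
interpretation V: vector_space sV by (rule vs)

lemma pure_tensor_add_left: "pure_tensor sU sV (u + u') v = pure_tensor sU sV u v + pure_tensor sU sV u' v"
  and pure_tensor_add_right: "pure_tensor sU sV u (v + v') = pure_tensor sU sV u v + pure_tensor sU sV u v'"
  and pure_tensor_scale_left: "pure_tensor sU sV (sU c u) v = fscale c (pure_tensor sU sV u v)"
  and pure_tensor_scale_right: "pure_tensor sU sV u (sV c v) = fscale c (pure_tensor sU sV u v)"
  by (auto simp: pure_tensor_def fun_eq_iff fun_simps bilinear_form_iff[OF vs] bilin_on_def lin_on_def)

lemma pure_in_tensor_space: "\<lbrakk>u \<in> U; v \<in> V\<rbrakk> \<Longrightarrow> pure_tensor sU sV u v \<in> tensor_space sU sV U V"
  by (auto simp: tensor_space_def intro!: exI[of _ "[(u, v)]"])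

lemma tensor_space_sumI:
  "set xs \<subseteq> U \<times> V \<Longrightarrow> (\<Sum>(u, v)\<leftarrow>xs. pure_tensor sU sV u v) \<in> tensor_space sU sV U V"
  by (auto simp: tensor_space_def)

lemma tensor_space_add: "\<lbrakk>s \<in> tensor_space sU sV U V; t \<in> tensor_space sU sV U V\<rbrakk> \<Longrightarrow> s + t \<in> tensor_space sU sV U V"
  unfolding tensor_space_def
proof clarify
  fix xs ys assume "set xs \<subseteq> U \<times> V" "set ys \<subseteq> U \<times> V"
  then show "\<exists>zs. set zs \<subseteq> U \<times> V \<and> (\<Sum>(u, v)\<leftarrow>xs. pure_tensor sU sV u v) +
     (\<Sum>(u, v)\<leftarrow>ys. pure_tensor sU sV u v) = (\<Sum>(u, v)\<leftarrow>zs. pure_tensor sU sV u v)"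
    by (intro exI[of _ "xs @ ys"]) auto
qed

lemma fscale_sum_pure_tensor:
  "fscale c (\<Sum>(u, v)\<leftarrow>xs. pure_tensor sU sV u v) =
    (\<Sum>(u, v)\<leftarrow>map (\<lambda>(u, v). (sU c u, v)) xs. pure_tensor sU sV u v)"
  by (induction xs) (auto simp: pure_tensor_scale_left fscale_add fscale_0)

lemma tensor_space_0: "0 \<in> tensor_space sU sV U V"
  using tensor_space_sumI[of "[]"] by simp

lemma subspace_tensor_space: "module.subspace fscale (tensor_space sU sV U V)"
proof -
  interpret T: vector_space "fscale :: 'k \<Rightarrow> ('u, 'v, 'k) tensor \<Rightarrow> _" by simp
  show ?thesis
  proof (rule T.subspaceI)
    fix c t assume "t \<in> tensor_space sU sV U V"
    then obtain xs where xs: "set xs \<subseteq> U \<times> V" "t = (\<Sum>(u, v)\<leftarrow>xs. pure_tensor sU sV u v)"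
      by (auto simp: tensor_space_def)
    show "fscale c t \<in> tensor_space sU sV U V"
      unfolding xs(2) fscale_sum_pure_tensor
      by (rule tensor_space_sumI) (use xs(1) U.subspace_scale[OF sub(1)] in auto)
  qed (rule tensor_space_0 tensor_space_add; assumption)+
qed

lemma tensor_lift_sum_list:
  assumes "vector_space sW" "bilin_on sU sV sW U V f" "set xs \<subseteq> U \<times> V"
  shows "tensor_lift sU sV U V (\<Sum>(u, v)\<leftarrow>xs. pure_tensor sU sV u v) f = (\<Sum>(u, v)\<leftarrow>xs. f u v)"
  by (rule tensor_lift_sum[OF vs assms(1) sub _ _ _ _ assms(3)])
    (use assms(2) in \<open>auto simp: bilin_on_def lin_on_def\<close>)

lemma tensor_lift_pure:
  assumes "vector_space sW" "bilin_on sU sV sW U V f" "u \<in> U" "v \<in> V"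
  shows "tensor_lift sU sV U V (pure_tensor sU sV u v) f = f u v"
  using tensor_lift_sum_list[OF assms(1,2), of "[(u, v)]"] assms(3,4) by simp

text \<open>Decompositions of \<open>s\<close> and \<open>t\<close> concatenate to one of
  \<open>s + t\<close>, and scaling the left factors gives one of \<open>fscale c t\<close>.
  Bilinearity makes the lift blind to which decomposition is chosen.\<close>

lemma lin_on_tensor_lift:
  assumes sW: "vector_space sW" and f: "bilin_on sU sV sW U V f"
  shows "lin_on fscale sW (tensor_space sU sV U V) (\<lambda>t. tensor_lift sU sV U V t f)"
proof (rule lin_onI)
  interpret W: vector_space sW by fact
  fix s t assume "s \<in> tensor_space sU sV U V" "t \<in> tensor_space sU sV U V"
  then obtain xs ys where xs: "set xs \<subseteq> U \<times> V" "s = (\<Sum>(u, v)\<leftarrow>xs. pure_tensor sU sV u v)"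
    and ys: "set ys \<subseteq> U \<times> V" "t = (\<Sum>(u, v)\<leftarrow>ys. pure_tensor sU sV u v)"
    by (auto simp: tensor_space_def)
  show "tensor_lift sU sV U V (s + t) f = tensor_lift sU sV U V s f + tensor_lift sU sV U V t f"
    using xs ys tensor_lift_sum_list[OF sW f, of "xs @ ys"] tensor_lift_sum_list[OF sW f, of xs]
      tensor_lift_sum_list[OF sW f, of ys] by simp
next
  interpret W: vector_space sW by fact
  fix c t assume "t \<in> tensor_space sU sV U V"
  then obtain xs where xs: "set xs \<subseteq> U \<times> V" "t = (\<Sum>(u, v)\<leftarrow>xs. pure_tensor sU sV u v)"
    by (auto simp: tensor_space_def)
  have "(\<Sum>(u, v)\<leftarrow>map (\<lambda>(u, v). (sU c u, v)) xs. f u v) = sW c (\<Sum>(u, v)\<leftarrow>xs. f u v)"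
    using xs(1) f by (induction xs) (auto simp: W.scale_right_distrib bilin_on_def lin_on_def)
  moreover have "set (map (\<lambda>(u, v). (sU c u, v)) xs) \<subseteq> U \<times> V"
    using xs(1) U.subspace_scale[OF sub(1)] by auto
  ultimately show "tensor_lift sU sV U V (fscale c t) f = sW c (tensor_lift sU sV U V t f)"
    unfolding xs(2) fscale_sum_pure_tensor
    using xs(1) tensor_lift_sum_list[OF sW f] by metis
qed

lemma lin_on_tensor_eqI:
  assumes sW: "vector_space sW" and g: "lin_on fscale sW (tensor_space sU sV U V) g"
    and h: "lin_on fscale sW (tensor_space sU sV U V) h"
    and eq: "\<And>u v. \<lbrakk>u \<in> U; v \<in> V\<rbrakk> \<Longrightarrow> g (pure_tensor sU sV u v) = h (pure_tensor sU sV u v)"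
    and t: "t \<in> tensor_space sU sV U V"
  shows "g t = h t"
proof -
  interpret W: vector_space sW by fact
  have "g 0 = g 0 + g 0" "h 0 = h 0 + h 0"
    using lin_on_add[OF g tensor_space_0 tensor_space_0] lin_on_add[OF h tensor_space_0 tensor_space_0]
    by simp_all
  then have 0: "g 0 = h 0" by simp
  have "g (\<Sum>(u, v)\<leftarrow>xs. pure_tensor sU sV u v) = h (\<Sum>(u, v)\<leftarrow>xs. pure_tensor sU sV u v)"
    if "set xs \<subseteq> U \<times> V" for xs
    using that
  proof (induction xs)
    case (Cons z zs)
    then show ?case
      by (cases z) (auto simp: lin_on_add[OF g] lin_on_add[OF h] pure_in_tensor_space tensor_space_sumI eq)
  qed (simp add: 0)
  then show ?thesis
    using t by (auto simp: tensor_space_def)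
qed

end

text \<open>
  For a linear functional \<open>\<phi>\<close>, applying \<open>\<phi>\<close> to \<open>\<Sum>\<^sub>i v\<^sub>i(y) u\<^sub>i = 0\<close> gives \<open>\<Sum>\<^sub>i \<phi>(u\<^sub>i) v\<^sub>i = 0\<close>; taking for
  \<open>\<phi>\<close> the coordinates of the span of the \<open>u\<^sub>i\<close> kills \<open>\<Sum>\<^sub>i u\<^sub>i \<otimes> v\<^sub>i\<close>.
\<close>

lemma sum_pure_tensor_eq_0:
  fixes xs :: "(('a \<Rightarrow> 'k::field) \<times> ('b \<Rightarrow> 'k)) list"
  assumes "\<And>a b. (\<Sum>(u, v)\<leftarrow>xs. u a * v b) = 0"
  shows "(\<Sum>(u, v)\<leftarrow>xs. pure_tensor fscale fscale u v) = 0"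
proof
  interpret A: vector_space "fscale :: 'k \<Rightarrow> ('a \<Rightarrow> 'k) \<Rightarrow> _" by simp
  interpret B: vector_space "fscale :: 'k \<Rightarrow> ('b \<Rightarrow> 'k) \<Rightarrow> _" by simp
  fix f :: "('a \<Rightarrow> 'k) \<Rightarrow> ('b \<Rightarrow> 'k) \<Rightarrow> 'k"
  show "(\<Sum>(u, v)\<leftarrow>xs. pure_tensor fscale fscale u v) f = 0 f"
  proof (cases "bilinear_form fscale fscale f")
    case False
    then have "(\<Sum>(u, v)\<leftarrow>ys. pure_tensor fscale fscale u v) f = 0" for ys
      by (induction ys) (auto simp: pure_tensor_def fun_simps)
    then show ?thesis by (simp add: zero_fun_apply)
  next
    case True
    then have f: "bilin_on fscale fscale (*) UNIV UNIV f"
      by (simp add: bilinear_form_iff)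
    have f_add: "f (u + u') v = f u v + f u' v" "f u (v + v') = f u v + f u v'"
      and f_scale: "f (fscale c u) v = c * f u v" "f u (fscale c v) = c * f u v" for u u' v v' c
      using f by (auto simp: bilin_on_def lin_on_def)
    have f_0: "f 0 v = 0" "f u 0 = 0" for u v
      using f_scale(1)[of 0 0 v] f_scale(2)[of u 0 0] by (simp_all only: A.scale_zero_left B.scale_zero_left mult_zero_left)
    obtain E where E: "E \<subseteq> fst ` set xs" "A.independent E" "fst ` set xs \<subseteq> A.span E"
      using A.maximal_independent_subset by blast
    have fin: "finite E" using E(1) finite_subset by blast
    define r where "r = A.representation E"
    have vanish: "(\<Sum>(u, v)\<leftarrow>xs. fscale (r u e) v) = 0" for e
    proof
      fix b
      have coord: "(\<Sum>(u, v)\<leftarrow>ys. fscale (v b) u) \<in> A.span E \<and>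
          r (\<Sum>(u, v)\<leftarrow>ys. fscale (v b) u) e = (\<Sum>(u, v)\<leftarrow>ys. fscale (r u e) v) b"
        if "set ys \<subseteq> set xs" for ys
        using that
      proof (induction ys)
        case Nil
        then show ?case by (simp add: A.span_zero r_def A.representation_zero) (simp add: zero_fun_apply)
      next
        case (Cons z ys)
        obtain u v where z: "z = (u, v)" by (cases z)
        have u: "u \<in> A.span E" using Cons.prems E(3) z by force
        have IH: "(\<Sum>(u, v)\<leftarrow>ys. fscale (v b) u) \<in> A.span E"
          "r (\<Sum>(u, v)\<leftarrow>ys. fscale (v b) u) e = (\<Sum>(u, v)\<leftarrow>ys. fscale (r u e) v) b"
          using Cons by auto
        have "r (fscale (v b) u + (\<Sum>(u, v)\<leftarrow>ys. fscale (v b) u)) e =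
            v b * r u e + r (\<Sum>(u, v)\<leftarrow>ys. fscale (v b) u) e"
          unfolding r_def
          by (simp add: A.representation_add[OF E(2) IH(1) A.span_scale[OF u]] A.representation_scale[OF E(2) u])
        then show ?case
          using IH u by (simp add: z A.span_add A.span_scale) (simp add: mult.commute fun_simps)
      qed
      have "(\<Sum>(u, v)\<leftarrow>xs. fscale (v b) u) = 0"
        using assms[of _ b] by (simp add: fun_eq_iff fun_simps sum_list_fun_apply case_prod_unfold mult.commute)
      then have "(\<Sum>(u, v)\<leftarrow>xs. fscale (r u e) v) b = r 0 e"
        using coord[OF order_refl] by simp
      then show "(\<Sum>(u, v)\<leftarrow>xs. fscale (r u e) v) b = 0 b"
        by (simp add: r_def A.representation_zero zero_fun_apply)
    qed
    \<comment> \<open>Each \<open>u\<close> is expanded in \<open>E\<close> and its coefficients are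
      moved into the second argument of \<open>f\<close>; there they collect to the sums that
      vanish.\<close>
    have "(\<Sum>(u, v)\<leftarrow>ys. f u v) = (\<Sum>e\<in>E. f e (\<Sum>(u, v)\<leftarrow>ys. fscale (r u e) v))"
      if "set ys \<subseteq> set xs" for ys
      using that
    proof (induction ys)
      case (Cons z ys)
      obtain u v where z: "z = (u, v)" by (cases z)
      have u: "u \<in> A.span E" using Cons.prems E(3) z by force
      have "u = (\<Sum>e\<in>E. fscale (r u e) e)"
        using A.sum_representation_eq[OF E(2) u fin] by (simp add: r_def)
      then have "f u v = f (\<Sum>e\<in>E. fscale (r u e) e) v" by simp
      also have "\<dots> = (\<Sum>e\<in>E. f e (fscale (r u e) v))"
        using fin by (induction E rule: finite_induct) (auto simp: f_0 f_add f_scale)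
      finally show ?case
        using Cons by (simp add: z f_add sum.distrib)
    qed (simp add: f_0)
    from this[OF order_refl] have "(\<Sum>(u, v)\<leftarrow>xs. f u v) = 0"
      by (simp add: vanish f_0)
    moreover have "(\<Sum>(u, v)\<leftarrow>ys. pure_tensor fscale fscale u v) f = (\<Sum>(u, v)\<leftarrow>ys. f u v)" for ys
      using True by (induction ys) (auto simp: pure_tensor_def fun_simps)
    ultimately show ?thesis by (simp add: zero_fun_apply)
  qed
qed

text \<open>Applied to \<open>xs\<close> followed by \<open>ys\<close> with negated left factors,
  the preceding lemma shows that tensors of functions inject into functions of two variables. This
  gives uniqueness of the tensor described in \<open>dual_comult\<close>.\<close>

lemma sum_pure_tensor_eqI:
  fixes xs ys :: "(('a \<Rightarrow> 'k::field) \<times> ('b \<Rightarrow> 'k)) list"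
  assumes "\<And>a b. (\<Sum>(u, v)\<leftarrow>xs. u a * v b) = (\<Sum>(u, v)\<leftarrow>ys. u a * v b)"
  shows "(\<Sum>(u, v)\<leftarrow>xs. pure_tensor fscale fscale u v) = (\<Sum>(u, v)\<leftarrow>ys. pure_tensor fscale fscale u v)"
proof -
  interpret A: vector_space "fscale :: 'k \<Rightarrow> ('a \<Rightarrow> 'k) \<Rightarrow> _" by simp
  interpret B: vector_space "fscale :: 'k \<Rightarrow> ('b \<Rightarrow> 'k) \<Rightarrow> _" by simp
  interpret tensor_factors "fscale :: 'k \<Rightarrow> ('a \<Rightarrow> 'k) \<Rightarrow> _" "fscale :: 'k \<Rightarrow> ('b \<Rightarrow> 'k) \<Rightarrow> _" UNIV UNIV
    by unfold_locales (simp_all add: A.subspace_UNIV B.subspace_UNIV A.vector_space_axioms B.vector_space_axioms)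
  let ?n = "map (\<lambda>(u, v). (fscale (- 1) u, v))"
  have n: "(\<Sum>(u, v)\<leftarrow>?n ys. u a * v b) = - (\<Sum>(u, v)\<leftarrow>ys. u a * v b)" for a b
    by (induction ys) (auto simp: fun_simps)
  have "(\<Sum>(u, v)\<leftarrow>xs @ ?n ys. pure_tensor fscale fscale u v) = 0"
    by (rule sum_pure_tensor_eq_0) (use n assms in simp)
  then have "(\<Sum>(u, v)\<leftarrow>xs. pure_tensor fscale fscale u v) +
      fscale (- 1) (\<Sum>(u, v)\<leftarrow>ys. pure_tensor fscale fscale u v) = 0"
    unfolding fscale_sum_pure_tensor by simp
  then show ?thesis
    by (simp add: fun_eq_iff fun_simps)
qed


section \<open>The finite dual of an algebra\<close>

lemma sum_list_swap:
  fixes f :: "'a \<Rightarrow> 'b \<Rightarrow> 'c::comm_monoid_add"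
  shows "(\<Sum>x\<leftarrow>xs. \<Sum>y\<leftarrow>ys. f x y) = (\<Sum>y\<leftarrow>ys. \<Sum>x\<leftarrow>xs. f x y)"
  by (induction xs) (simp_all add: sum_list_addf)

context unital_algebra
begin

abbreviation functional :: "('b \<Rightarrow> 'k) \<Rightarrow> bool"
  where "functional \<equiv> lin_on scale (*) UNIV"

lemma linear_iff_functional: "Vector_Spaces.linear scale (*) \<phi> \<longleftrightarrow> functional \<phi>"
  by (rule linear_iff_lin_on[OF vector_space_axioms vector_space_field])

lemma functional_add: "functional \<phi> \<Longrightarrow> \<phi> (x + y) = \<phi> x + \<phi> y"
  and functional_scale: "functional \<phi> \<Longrightarrow> \<phi> (scale c x) = c * \<phi> x"
  by (simp_all add: lin_on_def)

lemma functional_0: "functional \<phi> \<Longrightarrow> \<phi> 0 = 0"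
  using functional_scale[of \<phi> 0 0] by simp

lemma functional_diff: "functional \<phi> \<Longrightarrow> \<phi> (x - y) = \<phi> x - \<phi> y"
  using functional_add[of \<phi> "x - y" y] by simp

lemma functional_sum_list: "functional \<phi> \<Longrightarrow> \<phi> (\<Sum>x\<leftarrow>xs. f x) = (\<Sum>x\<leftarrow>xs. \<phi> (f x))"
  by (induction xs) (auto simp: functional_0 functional_add)

lemma functional_mult:
  assumes "functional \<phi>"
  shows "functional (\<lambda>x. \<phi> (b * x))" "functional (\<lambda>x. \<phi> (x * b))"
  using assms by (auto simp: lin_on_def distrib_left distrib_right scale_mult_left scale_mult_right)

lemma subspace_kernels:
  "(\<And>\<phi>. \<phi> \<in> \<Phi> \<Longrightarrow> functional \<phi>) \<Longrightarrow> subspace {x. \<forall>\<phi>\<in>\<Phi>. \<phi> x = 0}"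
  by (auto simp: subspace_def functional_0 functional_add functional_scale)

section \<open>Finite codimension and dual bases of quotients\<close>

lemma span_eq_UNIV: "\<lbrakk>span A = UNIV; A \<subseteq> span B\<rbrakk> \<Longrightarrow> span B = UNIV"
  using span_minimal[of A "span B"] by auto

lemma finite_codimension_mono: "\<lbrakk>finite_codimension I; I \<subseteq> J\<rbrakk> \<Longrightarrow> finite_codimension J"
proof -
  assume "finite_codimension I" "I \<subseteq> J"
  then obtain F where F: "finite F" "span (I \<union> F) = UNIV"
    unfolding finite_codimension_def by blast
  have "span (J \<union> F) = UNIV"
    by (rule span_eq_UNIV[OF F(2)]) (use \<open>I \<subseteq> J\<close> span_superset in blast)
  with F(1) show ?thesis
    unfolding finite_codimension_def by blast
qed

text \<open>Cutting with one more kernel costs at most one dimension: if some \<open>v\<close> in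
  \<open>I\<close> has \<open>\<phi> v \<noteq> 0\<close>, adjoining \<open>v\<close> to the finite
  spanning set compensates.\<close>

lemma finite_codimension_Int_kernel:
  assumes I: "subspace I" "finite_codimension I" and \<phi>: "functional \<phi>"
  shows "finite_codimension (I \<inter> {x. \<phi> x = 0})"
proof (cases "\<forall>x\<in>I. \<phi> x = 0")
  case True
  then have "I \<inter> {x. \<phi> x = 0} = I" by auto
  with I(2) show ?thesis by simp
next
  case False
  then obtain v where v: "v \<in> I" "\<phi> v \<noteq> 0" by auto
  obtain F where F: "finite F" "span (I \<union> F) = UNIV"
    using I(2) by (auto simp: finite_codimension_def)
  let ?J = "I \<inter> {x. \<phi> x = 0}"
  have "x \<in> span (?J \<union> insert v F)" if "x \<in> I" for x
  proof -
    let ?c = "\<phi> x / \<phi> v"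
    have "x - scale ?c v \<in> ?J"
      using that v I(1) by (auto simp: subspace_diff subspace_scale functional_diff[OF \<phi>] functional_scale[OF \<phi>])
    then have "x - scale ?c v \<in> span (?J \<union> insert v F)" by (intro span_base) auto
    moreover have "scale ?c v \<in> span (?J \<union> insert v F)"
      by (intro span_scale span_base) auto
    ultimately show ?thesis
      using span_add[of "x - scale ?c v" _ "scale ?c v"] by simp
  qed
  then have "I \<union> F \<subseteq> span (?J \<union> insert v F)"
    by (auto intro: span_base)
  then have "span (?J \<union> insert v F) = UNIV"
    by (rule span_eq_UNIV[OF F(2)])
  then show ?thesis
    using F(1) unfolding finite_codimension_def by (intro exI[of _ "insert v F"]) simp
qed

text \<open>The source of finite codimension for the intersections, the preimages and the ideal of a
  convolution product below: each contains the common zeros of finitely many functionals.\<close>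

lemma finite_codimension_kernels:
  assumes "finite \<Phi>" "\<And>\<phi>. \<phi> \<in> \<Phi> \<Longrightarrow> functional \<phi>"
  shows "finite_codimension {x. \<forall>\<phi>\<in>\<Phi>. \<phi> x = 0}"
  using assms
proof (induction \<Phi>)
  case empty
  then show ?case by (auto simp: finite_codimension_def intro!: exI[of _ "{}"])
next
  case (insert \<phi> \<Phi>)
  have "{x. \<forall>\<psi>\<in>insert \<phi> \<Phi>. \<psi> x = 0} = {x. \<forall>\<psi>\<in>\<Phi>. \<psi> x = 0} \<inter> {x. \<phi> x = 0}" by auto
  then show ?case
    using insert finite_codimension_Int_kernel[OF subspace_kernels[of \<Phi>]] by simp
qed

text \<open>
  The \<open>e\<close> stand for a basis of the quotient by \<open>I\<close> and the \<open>\<phi>\<close> for its dual basis; linear independence of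
  the \<open>e\<close> is never needed.
\<close>

definition dual_basis_mod :: "'b set \<Rightarrow> (('b \<Rightarrow> 'k) \<times> 'b) list \<Rightarrow> bool"
  where "dual_basis_mod I ps \<longleftrightarrow> (\<forall>(\<phi>, e)\<in>set ps. functional \<phi> \<and> (\<forall>x\<in>I. \<phi> x = 0)) \<and>
    (\<forall>x. x - (\<Sum>(\<phi>, e)\<leftarrow>ps. scale (\<phi> x) e) \<in> I)"

text \<open>A basis \<open>C\<close> of \<open>I\<close> is extended by vectors of the finite set
  \<open>F\<close> to a basis \<open>D\<close> of the whole algebra. The added vectors serve as the
  \<open>e\<close>, their coordinate functionals as the \<open>\<phi>\<close>.\<close>

lemma dual_basis_mod_exists:
  assumes I: "subspace I" and "finite_codimension I"
  shows "\<exists>ps. dual_basis_mod I ps"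
proof -
  obtain F where F: "finite F" "span (I \<union> F) = UNIV"
    using assms(2) by (auto simp: finite_codimension_def)
  obtain C where C: "C \<subseteq> I" "independent C" "I \<subseteq> span C"
    using maximal_independent_subset by blast
  have spanC: "span C = I"
    using C span_minimal[OF C(1) I] by auto
  obtain D where D: "C \<subseteq> D" "D \<subseteq> C \<union> F" "independent D" "C \<union> F \<subseteq> span D"
    using maximal_independent_subset_extend[of C "C \<union> F"] C by auto
  have "I \<union> F \<subseteq> span D"
    using D(1,4) spanC span_mono[OF D(1)] by blast
  then have spanD: "span D = UNIV"
    by (rule span_eq_UNIV[OF F(2)])
  have "finite (D - C)"
    using D(2) F(1) by (auto intro: finite_subset)
  then obtain es where es: "set es = D - C" "distinct es"
    using finite_distinct_list by blast
  define \<phi> where "\<phi> = (\<lambda>e x. representation D x e)"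
  have "functional (\<phi> e)" for e
    unfolding \<phi>_def lin_on_def
    using representation_add[OF D(3)] representation_scale[OF D(3)] spanD by simp
  \<comment> \<open>A vector of \<open>I\<close>, the span of \<open>C\<close>, has the same
    coordinates over \<open>C\<close> and over \<open>D\<close>, so those outside \<open>C\<close>
    are zero.\<close>
  moreover have "\<phi> e x = 0" if "x \<in> I" "e \<notin> C" for e x
    using that representation_extend[OF D(3) _ D(1)] representation_ne_zero[of C x e] spanC
    by (auto simp: \<phi>_def)
  moreover have "x - (\<Sum>(\<phi>, e)\<leftarrow>map (\<lambda>e. (\<phi> e, e)) es. scale (\<phi> x) e) \<in> I" for x
  proof -
    let ?r = "representation D x" and ?S = "{b. representation D x b \<noteq> 0}"
    have fin: "finite ?S" by (rule finite_representation)
    have sub: "?S \<subseteq> D" using representation_ne_zero by blast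
    have "(\<Sum>(\<phi>, e)\<leftarrow>map (\<lambda>e. (\<phi> e, e)) es. scale (\<phi> x) e) = (\<Sum>e\<in>D - C. scale (?r e) e)"
      using es by (simp add: \<phi>_def o_def sum_list_distinct_conv_sum_set)
    also have "\<dots> = (\<Sum>e\<in>?S - C. scale (?r e) e)"
      using \<open>finite (D - C)\<close> sub by (intro sum.mono_neutral_right) auto
    finally have "x - (\<Sum>(\<phi>, e)\<leftarrow>map (\<lambda>e. (\<phi> e, e)) es. scale (\<phi> x) e) =
        (\<Sum>e\<in>?S. scale (?r e) e) - (\<Sum>e\<in>?S - C. scale (?r e) e)"
      using sum_nonzero_representation_eq[OF D(3)] spanD by simp
    also have "\<dots> = (\<Sum>e\<in>?S \<inter> C. scale (?r e) e)"
      using sum.Int_Diff[OF fin, of "\<lambda>e. scale (?r e) e" C] by simp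
    also have "\<dots> \<in> I"
      using C(1) I by (intro subspace_sum subspace_scale) auto
    finally show ?thesis .
  qed
  ultimately have "dual_basis_mod I (map (\<lambda>e. (\<phi> e, e)) es)"
    using es by (auto simp: dual_basis_mod_def)
  then show ?thesis by blast
qed

lemma dual_basis_mod_expand:
  assumes ps: "dual_basis_mod I ps" and "functional \<beta>" "\<And>x. x \<in> I \<Longrightarrow> \<beta> x = 0"
  shows "\<beta> x = (\<Sum>(\<phi>, e)\<leftarrow>ps. \<phi> x * \<beta> e)"
proof -
  have "\<beta> (x - (\<Sum>(\<phi>, e)\<leftarrow>ps. scale (\<phi> x) e)) = 0"
    using assms by (simp add: dual_basis_mod_def)
  then show ?thesis
    using assms(2) by (simp add: functional_diff functional_sum_list case_prod_unfold functional_scale)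
qed

section \<open>The finite dual as a subspace stable under translations\<close>

lemma fdualE:
  assumes "\<beta> \<in> fdual"
  obtains I where "functional \<beta>" "two_sided_ideal I" "finite_codimension I" "\<And>x. x \<in> I \<Longrightarrow> \<beta> x = 0"
  using assms by (auto simp: fdual_def linear_iff_functional)

lemma fdualI:
  "\<lbrakk>functional \<beta>; two_sided_ideal I; finite_codimension I; \<And>x. x \<in> I \<Longrightarrow> \<beta> x = 0\<rbrakk> \<Longrightarrow> \<beta> \<in> fdual"
  by (auto simp: fdual_def linear_iff_functional)

lemma functional_fdual: "\<beta> \<in> fdual \<Longrightarrow> functional \<beta>"
  by (auto elim: fdualE)

lemma two_sided_idealD:
  assumes "two_sided_ideal I"
  shows "subspace I" "x \<in> I \<Longrightarrow> b * x \<in> I" "x \<in> I \<Longrightarrow> x * b \<in> I"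
  using assms by (auto simp: two_sided_ideal_def)

text \<open>If all functionals of a dual basis modulo \<open>K\<close> vanish at \<open>x\<close>,
  the expansion of \<open>x\<close> is zero and \<open>x\<close> lies in \<open>K\<close>. So the
  common zeros of the functionals from both dual bases lie in the intersection.\<close>

lemma finite_codimension_Int:
  assumes "subspace I" "finite_codimension I" "subspace J" "finite_codimension J"
  shows "finite_codimension (I \<inter> J)"
proof -
  obtain ps qs where ps: "dual_basis_mod I ps" and qs: "dual_basis_mod J qs"
    using dual_basis_mod_exists[OF assms(1,2)] dual_basis_mod_exists[OF assms(3,4)] by auto
  let ?\<Phi> = "fst ` set ps \<union> fst ` set qs"
  have "x \<in> K" if "dual_basis_mod K rs" "\<forall>\<phi>\<in>fst ` set rs. \<phi> x = 0" for x K rs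
  proof -
    have "(\<Sum>(\<phi>, e)\<leftarrow>ts. scale (\<phi> x) e) = 0" if "\<forall>\<phi>\<in>fst ` set ts. \<phi> x = 0" for ts
      using that by (induction ts) auto
    then have "(\<Sum>(\<phi>, e)\<leftarrow>rs. scale (\<phi> x) e) = 0"
      using that(2) by blast
    moreover have "x - (\<Sum>(\<phi>, e)\<leftarrow>rs. scale (\<phi> x) e) \<in> K"
      using that(1) by (simp add: dual_basis_mod_def)
    ultimately show ?thesis by simp
  qed
  then have "{x. \<forall>\<phi>\<in>?\<Phi>. \<phi> x = 0} \<subseteq> I \<inter> J"
    using ps qs by (auto simp: image_Un)
  moreover have "finite_codimension {x. \<forall>\<phi>\<in>?\<Phi>. \<phi> x = 0}"
    using ps qs by (intro finite_codimension_kernels) (auto simp: dual_basis_mod_def)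
  ultimately show ?thesis
    by (rule finite_codimension_mono[rotated])
qed

lemma subspace_fdual: "module.subspace fscale fdual"
proof -
  interpret D: vector_space "fscale :: 'k \<Rightarrow> ('b \<Rightarrow> 'k) \<Rightarrow> _" by simp
  show ?thesis
  proof (rule D.subspaceI)
    have "two_sided_ideal UNIV" "finite_codimension UNIV"
      by (auto simp: two_sided_ideal_def finite_codimension_def intro: exI[of _ "{}"])
    then show "0 \<in> fdual"
      by (rule fdualI[rotated]) (simp_all add: lin_on_def zero_fun_apply)
  next
    fix \<alpha> \<beta> assume "\<alpha> \<in> fdual" "\<beta> \<in> fdual"
    obtain I where I: "functional \<alpha>" "two_sided_ideal I" "finite_codimension I" "\<And>x. x \<in> I \<Longrightarrow> \<alpha> x = 0"
      using \<open>\<alpha> \<in> fdual\<close> fdualE by blast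
    obtain J where J: "functional \<beta>" "two_sided_ideal J" "finite_codimension J" "\<And>x. x \<in> J \<Longrightarrow> \<beta> x = 0"
      using \<open>\<beta> \<in> fdual\<close> fdualE by blast
    show "\<alpha> + \<beta> \<in> fdual"
    proof (rule fdualI)
      show "two_sided_ideal (I \<inter> J)"
        using I(2) J(2) by (auto simp: two_sided_ideal_def subspace_inter)
      show "finite_codimension (I \<inter> J)"
        using I J by (intro finite_codimension_Int) (auto simp: two_sided_ideal_def)
    qed (use I J in \<open>auto simp: lin_on_def plus_fun_apply algebra_simps\<close>)
  next
    fix c \<beta> assume "\<beta> \<in> fdual"
    then obtain I where "functional \<beta>" "two_sided_ideal I" "finite_codimension I" "\<And>x. x \<in> I \<Longrightarrow> \<beta> x = 0"
      using fdualE by blast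
    then show "fscale c \<beta> \<in> fdual"
      by (intro fdualI[of _ I]) (auto simp: lin_on_def fscale_apply algebra_simps)
  qed
qed

lemma tensor_factors_fdual: "tensor_factors fscale fscale fdual fdual"
  by (rule tensor_factors.intro[OF vector_space_fscale vector_space_fscale subspace_fdual subspace_fdual])

interpretation fdual: tensor_factors fscale fscale fdual fdual
  by (rule tensor_factors_fdual)

lemma vanishing_shift:
  assumes "two_sided_ideal I" "\<And>x. x \<in> I \<Longrightarrow> \<beta> x = 0" "x \<in> I"
  shows "\<beta> (x * b) = 0" "\<beta> (b * x) = 0"
  using assms by (auto simp: two_sided_ideal_def)

lemma fdual_mult:
  assumes "\<beta> \<in> fdual"
  shows "(\<lambda>x. \<beta> (x * b)) \<in> fdual" "(\<lambda>x. \<beta> (b * x)) \<in> fdual"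
proof -
  obtain I where "functional \<beta>" "two_sided_ideal I" "finite_codimension I" "\<And>x. x \<in> I \<Longrightarrow> \<beta> x = 0"
    using assms fdualE by blast
  then show "(\<lambda>x. \<beta> (x * b)) \<in> fdual" "(\<lambda>x. \<beta> (b * x)) \<in> fdual"
    by (auto intro!: fdualI[of _ I] functional_mult simp: vanishing_shift)
qed

section \<open>The coproduct of the finite dual\<close>

lemma dual_basis_mod_fdual:
  assumes "two_sided_ideal I" "finite_codimension I" "dual_basis_mod I ps" "(\<phi>, e) \<in> set ps"
  shows "\<phi> \<in> fdual"
  using assms by (intro fdualI[of _ I]) (auto simp: dual_basis_mod_def)

text \<open>Existence is the given decomposition, uniqueness is \<open>sum_pure_tensor_eqI\<close>.
  From here on the coproduct of a functional is computed from whichever decomposition of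
  \<open>\<beta> (a * b)\<close> is at hand.\<close>

lemma dual_comult_eqI:
  assumes "set xs \<subseteq> fdual \<times> fdual" "\<And>a b. \<beta> (a * b) = (\<Sum>(u, v)\<leftarrow>xs. u a * v b)"
  shows "dual_comult \<beta> = (\<Sum>(u, v)\<leftarrow>xs. pure_tensor fscale fscale u v)"
proof -
  have bil: "bilin_on fscale fscale (*) fdual fdual (\<lambda>u v. u a * v b)" for a b
    by (intro bilin_onI lin_onI) (simp_all add: fun_simps algebra_simps)
  have eval: "tensor_lift fscale fscale fdual fdual (\<Sum>(u, v)\<leftarrow>ys. pure_tensor fscale fscale u v)
      (\<lambda>u v. u a * v b) = (\<Sum>(u, v)\<leftarrow>ys. u a * v b)" if "set ys \<subseteq> fdual \<times> fdual" for ys a b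
    by (rule fdual.tensor_lift_sum_list[OF vector_space_field bil that])
  show ?thesis
    unfolding dual_comult_def
  proof (rule the_equality)
    fix t assume t: "t \<in> tensor_space fscale fscale fdual fdual \<and>
      (\<forall>a b. \<beta> (a * b) = tensor_lift fscale fscale fdual fdual t (\<lambda>\<beta>' \<beta>''. \<beta>' a * \<beta>'' b))"
    then obtain ys where ys: "set ys \<subseteq> fdual \<times> fdual" "t = (\<Sum>(u, v)\<leftarrow>ys. pure_tensor fscale fscale u v)"
      by (auto simp: tensor_space_def)
    show "t = (\<Sum>(u, v)\<leftarrow>xs. pure_tensor fscale fscale u v)"
      unfolding ys(2) by (rule sum_pure_tensor_eqI) (use t ys(2) eval[OF ys(1)] assms(2) in auto)
  qed (use assms eval fdual.tensor_space_sumI in auto)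
qed

lemma dual_sweedler_eqI:
  assumes "set xs \<subseteq> fdual \<times> fdual" "\<And>a b. \<beta> (a * b) = (\<Sum>(u, v)\<leftarrow>xs. u a * v b)"
    and "vector_space sW" "bilin_on fscale fscale sW fdual fdual F"
  shows "dual_sweedler \<beta> F = (\<Sum>(u, v)\<leftarrow>xs. F u v)"
  unfolding dual_sweedler_def dual_comult_eqI[OF assms(1,2)]
  by (rule fdual.tensor_lift_sum_list[OF assms(3,4,1)])

text \<open>For fixed \<open>b\<close> the functional \<open>x \<mapsto> \<beta> (x * b)\<close>
  still vanishes on the two-sided ideal, hence expands in the dual basis; likewise with the fixed
  factor on the other side. So the dual basis may be put in the left or in the right tensor factor,
  and coassociativity uses both.\<close>

lemma dual_basis_mod_decomp:
  assumes I: "two_sided_ideal I" "finite_codimension I" "dual_basis_mod I ps"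
    and \<beta>: "functional \<beta>" "\<And>x. x \<in> I \<Longrightarrow> \<beta> x = 0"
  shows "set (map (\<lambda>(\<phi>, e). (\<phi>, \<lambda>x. \<beta> (e * x))) ps) \<subseteq> fdual \<times> fdual" (is "set ?L \<subseteq> _")
    and "set (map (\<lambda>(\<phi>, e). (\<lambda>x. \<beta> (x * e), \<phi>)) ps) \<subseteq> fdual \<times> fdual" (is "set ?R \<subseteq> _")
    and "\<beta> (a * b) = (\<Sum>(u, v)\<leftarrow>map (\<lambda>(\<phi>, e). (\<phi>, \<lambda>x. \<beta> (e * x))) ps. u a * v b)"
    and "\<beta> (a * b) = (\<Sum>(u, v)\<leftarrow>map (\<lambda>(\<phi>, e). (\<lambda>x. \<beta> (x * e), \<phi>)) ps. u a * v b)"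
proof -
  have "\<beta> \<in> fdual" by (rule fdualI) (use assms in auto)
  then show "set ?L \<subseteq> fdual \<times> fdual" "set ?R \<subseteq> fdual \<times> fdual"
    using dual_basis_mod_fdual[OF I] fdual_mult by auto
  have "\<beta> (a * b) = (\<Sum>(\<phi>, e)\<leftarrow>ps. \<phi> a * \<beta> (e * b))"
    by (rule dual_basis_mod_expand[OF I(3) functional_mult(2)[OF \<beta>(1), of b]])
      (rule vanishing_shift(1)[of I \<beta>, OF I(1) \<beta>(2)])
  then show "\<beta> (a * b) = (\<Sum>(u, v)\<leftarrow>?L. u a * v b)"
    by (simp add: o_def case_prod_unfold)
  have "\<beta> (a * b) = (\<Sum>(\<phi>, e)\<leftarrow>ps. \<phi> b * \<beta> (a * e))"
    by (rule dual_basis_mod_expand[OF I(3) functional_mult(1)[OF \<beta>(1), of a]])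
      (rule vanishing_shift(2)[of I \<beta>, OF I(1) \<beta>(2)])
  then show "\<beta> (a * b) = (\<Sum>(u, v)\<leftarrow>?R. u a * v b)"
    by (simp add: o_def case_prod_unfold mult.commute)
qed

lemma dual_basis_mod_sweedler:
  assumes I: "two_sided_ideal I" "finite_codimension I" "dual_basis_mod I ps"
    and \<beta>: "functional \<beta>" "\<And>x. x \<in> I \<Longrightarrow> \<beta> x = 0"
    and G: "vector_space sW" "bilin_on fscale fscale sW fdual fdual G"
  shows "dual_sweedler \<beta> G = (\<Sum>(\<phi>, e)\<leftarrow>ps. G \<phi> (\<lambda>x. \<beta> (e * x)))"
    and "dual_sweedler \<beta> G = (\<Sum>(\<phi>, e)\<leftarrow>ps. G (\<lambda>x. \<beta> (x * e)) \<phi>)"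
proof -
  note decomp = dual_basis_mod_decomp[OF I \<beta>]
  show "dual_sweedler \<beta> G = (\<Sum>(\<phi>, e)\<leftarrow>ps. G \<phi> (\<lambda>x. \<beta> (e * x)))"
    by (subst dual_sweedler_eqI[OF decomp(1,3) G]) (simp_all add: o_def case_prod_unfold)
  show "dual_sweedler \<beta> G = (\<Sum>(\<phi>, e)\<leftarrow>ps. G (\<lambda>x. \<beta> (x * e)) \<phi>)"
    by (subst dual_sweedler_eqI[OF decomp(2,4) G]) (simp_all add: o_def case_prod_unfold)
qed

lemma fdual_decomp:
  assumes "\<beta> \<in> fdual"
  shows "\<exists>xs. set xs \<subseteq> fdual \<times> fdual \<and> (\<forall>a b. \<beta> (a * b) = (\<Sum>(u, v)\<leftarrow>xs. u a * v b))"
proof -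
  obtain I where I: "functional \<beta>" "two_sided_ideal I" "finite_codimension I" "\<And>x. x \<in> I \<Longrightarrow> \<beta> x = 0"
    using assms fdualE by blast
  obtain ps where ps: "dual_basis_mod I ps"
    using dual_basis_mod_exists[OF two_sided_idealD(1)[OF I(2)] I(3)] by auto
  show ?thesis
    by (intro exI[of _ "map (\<lambda>(\<phi>, e). (\<phi>, \<lambda>x. \<beta> (e * x))) ps"] conjI allI
        dual_basis_mod_decomp(1,3)[of I ps \<beta>, OF I(2,3) ps I(1,4)])
qed

lemma dual_comult_in: "\<beta> \<in> fdual \<Longrightarrow> dual_comult \<beta> \<in> tensor_space fscale fscale fdual fdual"
  using fdual_decomp[of \<beta>] dual_comult_eqI[of _ \<beta>] fdual.tensor_space_sumI by force

lemma dual_sweedler_mult: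
  assumes "\<beta> \<in> fdual"
  shows "dual_sweedler \<beta> (\<lambda>\<beta>' \<beta>''. \<beta>' a * \<beta>'' b) = \<beta> (a * b)"
proof -
  obtain xs where xs: "set xs \<subseteq> fdual \<times> fdual" "\<And>a b. \<beta> (a * b) = (\<Sum>(u, v)\<leftarrow>xs. u a * v b)"
    using fdual_decomp[OF assms] by blast
  have bil: "bilin_on fscale fscale (*) fdual fdual (\<lambda>u v. u a * v b)"
    by (intro bilin_onI lin_onI) (simp_all add: fun_simps algebra_simps)
  show ?thesis
    using dual_sweedler_eqI[OF xs vector_space_field bil] xs(2) by simp
qed

text \<open>\<open>dual_comult\<close> is a definite description, so its linearity has to be earned:
  decompositions for \<open>\<beta>\<close> and \<open>\<gamma>\<close> concatenate to one for
  \<open>\<beta> + \<gamma>\<close>, and \<open>dual_sweedler_eqI\<close> recognises the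
  result.\<close>

lemma lin_on_dual_sweedler:
  assumes W: "vector_space sW" and F: "bilin_on fscale fscale sW fdual fdual F"
  shows "lin_on fscale sW fdual (\<lambda>\<beta>. dual_sweedler \<beta> F)"
proof (rule lin_onI)
  fix \<beta> \<gamma> assume "\<beta> \<in> fdual" "\<gamma> \<in> fdual"
  then obtain xs ys where xs: "set xs \<subseteq> fdual \<times> fdual" "\<And>a b. \<beta> (a * b) = (\<Sum>(u, v)\<leftarrow>xs. u a * v b)"
    and ys: "set ys \<subseteq> fdual \<times> fdual" "\<And>a b. \<gamma> (a * b) = (\<Sum>(u, v)\<leftarrow>ys. u a * v b)"
    using fdual_decomp[of \<beta>] fdual_decomp[of \<gamma>] by blast
  have "dual_sweedler (\<beta> + \<gamma>) F = (\<Sum>(u, v)\<leftarrow>xs @ ys. F u v)"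
    by (rule dual_sweedler_eqI[OF _ _ W F]) (use xs ys in \<open>simp_all add: plus_fun_apply\<close>)
  then show "dual_sweedler (\<beta> + \<gamma>) F = dual_sweedler \<beta> F + dual_sweedler \<gamma> F"
    using dual_sweedler_eqI[OF xs W F] dual_sweedler_eqI[OF ys W F] by simp
next
  interpret W: vector_space sW by fact
  interpret D: vector_space "fscale :: 'k \<Rightarrow> ('b \<Rightarrow> 'k) \<Rightarrow> _" by simp
  fix c \<beta> assume "\<beta> \<in> fdual"
  then obtain xs where xs: "set xs \<subseteq> fdual \<times> fdual" "\<And>a b. \<beta> (a * b) = (\<Sum>(u, v)\<leftarrow>xs. u a * v b)"
    using fdual_decomp[of \<beta>] by blast
  let ?ys = "map (\<lambda>(u, v). (fscale c u, v)) xs"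
  have "dual_sweedler (fscale c \<beta>) F = (\<Sum>(u, v)\<leftarrow>?ys. F u v)"
  proof (rule dual_sweedler_eqI[OF _ _ W F])
    show "fscale c \<beta> (a * b) = (\<Sum>(u, v)\<leftarrow>?ys. u a * v b)" for a b
      using xs(2) by (simp add: o_def case_prod_unfold fscale_apply mult.assoc sum_list_const_mult)
  qed (use xs(1) D.subspace_scale[OF subspace_fdual] in auto)
  also have "\<dots> = sW c (\<Sum>(u, v)\<leftarrow>xs. F u v)"
    using xs(1) F by (induction xs) (auto simp: W.scale_right_distrib bilin_on_def lin_on_def)
  finally show "dual_sweedler (fscale c \<beta>) F = sW c (dual_sweedler \<beta> F)"
    using dual_sweedler_eqI[OF xs W F] by simp
qed

text \<open>
  With a basis \<open>e\<^sub>i\<close> modulo the ideal killed by \<open>\<beta>\<close> and its dual basis \<open>\<phi>\<^sub>i\<close>, both sides are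
  \<open>\<Sum>\<^sub>i\<^sub>j F \<phi>\<^sub>j (\<lambda>x. \<beta> (e\<^sub>j x e\<^sub>i)) \<phi>\<^sub>i\<close>.
\<close>

lemma dual_coassoc:
  assumes \<beta>: "\<beta> \<in> fdual" and W: "vector_space sW"
    and F1: "\<And>v w. \<lbrakk>v \<in> fdual; w \<in> fdual\<rbrakk> \<Longrightarrow> lin_on fscale sW fdual (\<lambda>u. F u v w)"
    and F2: "\<And>u w. \<lbrakk>u \<in> fdual; w \<in> fdual\<rbrakk> \<Longrightarrow> lin_on fscale sW fdual (\<lambda>v. F u v w)"
    and F3: "\<And>u v. \<lbrakk>u \<in> fdual; v \<in> fdual\<rbrakk> \<Longrightarrow> lin_on fscale sW fdual (\<lambda>w. F u v w)"
  shows "dual_sweedler \<beta> (\<lambda>x w. dual_sweedler x (\<lambda>u v. F u v w)) =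
    dual_sweedler \<beta> (\<lambda>u y. dual_sweedler y (\<lambda>v w. F u v w))"
proof -
  obtain I where I: "functional \<beta>" "two_sided_ideal I" "finite_codimension I" "\<And>x. x \<in> I \<Longrightarrow> \<beta> x = 0"
    using \<beta> fdualE by blast
  obtain ps where ps: "dual_basis_mod I ps"
    using dual_basis_mod_exists[OF two_sided_idealD(1)[OF I(2)] I(3)] by auto
  note expand = dual_basis_mod_sweedler[OF I(2,3) ps _ _ W]
  have ps_fdual: "\<phi> \<in> fdual" if "(\<phi>, e) \<in> set ps" for \<phi> e
    using dual_basis_mod_fdual[OF I(2,3) ps that] .
  have bil12: "bilin_on fscale fscale sW fdual fdual (\<lambda>u v. F u v w)" if "w \<in> fdual" for w
    by (intro bilin_onI F1 F2 that)
  have bil23: "bilin_on fscale fscale sW fdual fdual (\<lambda>v w. F u v w)" if "u \<in> fdual" for u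
    by (intro bilin_onI F2 F3 that)
  have bilL: "bilin_on fscale fscale sW fdual fdual (\<lambda>x w. dual_sweedler x (\<lambda>u v. F u v w))"
    by (intro bilin_onI lin_on_dual_sweedler[OF W] bil12)
      (auto simp: dual_sweedler_def intro!: lin_on_tensor_lift_fun[OF _ W] dual_comult_in F3)
  have bilR: "bilin_on fscale fscale sW fdual fdual (\<lambda>u y. dual_sweedler y (\<lambda>v w. F u v w))"
    by (intro bilin_onI lin_on_dual_sweedler[OF W] bil23)
      (auto simp: dual_sweedler_def intro!: lin_on_tensor_lift_fun[OF _ W] dual_comult_in F1)
  have "dual_sweedler \<beta> (\<lambda>x w. dual_sweedler x (\<lambda>u v. F u v w)) =
      (\<Sum>(\<phi>, e)\<leftarrow>ps. dual_sweedler (\<lambda>x. \<beta> (x * e)) (\<lambda>u v. F u v \<phi>))"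
    by (rule expand(2)[OF I(1,4) bilL])
  \<comment> \<open>The functional \<open>x \<mapsto> \<beta> (x * e)\<close> also vanishes on
    \<open>I\<close>, so the same \<open>ps\<close> expands its coproduct, now with the dual basis
    on the left.\<close>
  also have "\<dots> = (\<Sum>(\<phi>, e)\<leftarrow>ps. \<Sum>(\<psi>, d)\<leftarrow>ps. F \<psi> (\<lambda>x. \<beta> (d * x * e)) \<phi>)"
  proof (intro arg_cong[of _ _ sum_list] map_cong refl, clarify)
    fix \<phi> e assume "(\<phi>, e) \<in> set ps"
    note bil = bil12[OF ps_fdual[OF this]]
    show "dual_sweedler (\<lambda>x. \<beta> (x * e)) (\<lambda>u v. F u v \<phi>) = (\<Sum>(\<psi>, d)\<leftarrow>ps. F \<psi> (\<lambda>x. \<beta> (d * x * e)) \<phi>)"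
      by (rule expand(1)[OF functional_mult(2)[OF I(1)] vanishing_shift(1)[of I \<beta>, OF I(2,4)] bil])
  qed
  also have "\<dots> = (\<Sum>(\<psi>, d)\<leftarrow>ps. \<Sum>(\<phi>, e)\<leftarrow>ps. F \<psi> (\<lambda>x. \<beta> (d * (x * e))) \<phi>)"
    unfolding case_prod_unfold mult.assoc by (rule sum_list_swap)
  also have "\<dots> = (\<Sum>(\<psi>, d)\<leftarrow>ps. dual_sweedler (\<lambda>x. \<beta> (d * x)) (\<lambda>v w. F \<psi> v w))"
  proof (intro arg_cong[of _ _ sum_list] map_cong refl, clarify)
    fix \<psi> d assume "(\<psi>, d) \<in> set ps"
    note bil = bil23[OF ps_fdual[OF this]]
    show "(\<Sum>(\<phi>, e)\<leftarrow>ps. F \<psi> (\<lambda>x. \<beta> (d * (x * e))) \<phi>) = dual_sweedler (\<lambda>x. \<beta> (d * x)) (\<lambda>v w. F \<psi> v w)"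
      by (rule expand(2)[OF functional_mult(1)[OF I(1)] vanishing_shift(2)[of I \<beta>, OF I(2,4)] bil, symmetric])
  qed
  also have "\<dots> = dual_sweedler \<beta> (\<lambda>u y. dual_sweedler y (\<lambda>v w. F u v w))"
    by (rule expand(1)[OF I(1,4) bilR, symmetric])
  finally show ?thesis .
qed

text \<open>Evaluated at \<open>x\<close>, the defining sum pairs the components of
  \<open>\<beta>\<close> with \<open>x\<close> and \<open>b\<close>, so the action is a translation
  of the argument.\<close>

lemma act_on_dual_eq:
  assumes "\<beta> \<in> fdual"
  shows "b \<rightharpoonup> \<beta> = (\<lambda>x. \<beta> (x * b))"
proof
  fix x
  have "(b \<rightharpoonup> \<beta>) x = dual_sweedler \<beta> (\<lambda>\<beta>' \<beta>''. \<beta>' x * \<beta>'' b)"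
    by (simp add: act_on_dual_def dual_sweedler_def tensor_lift_apply fscale_apply mult.commute)
  then show "(b \<rightharpoonup> \<beta>) x = \<beta> (x * b)"
    by (simp add: dual_sweedler_mult assms)
qed

end


section \<open>Sweedler calculus in a Hopf algebra\<close>

context hopf_algebra
begin

interpretation BB: tensor_factors scale scale UNIV UNIV
  by (intro tensor_factors.intro vector_space_axioms subspace_UNIV)

interpretation BBB: tensor_factors fscale scale "tensor_space scale scale UNIV UNIV" UNIV
  by (rule tensor_factors.intro[OF vector_space_fscale vector_space_axioms BB.subspace_tensor_space subspace_UNIV])

abbreviation lin where "lin \<equiv> lin_on scale scale UNIV"

lemma sweedler_add_fun: "sweedler b (\<lambda>x y. F x y + G x y) = sweedler b F + sweedler b G"
  by (simp add: sweedler_def tensor_lift_add_fun)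

lemma sweedler_scale_fun: "vector_space sW \<Longrightarrow> sweedler b (\<lambda>x y. sW c (F x y)) = sW c (sweedler b F)"
  by (simp add: sweedler_def tensor_lift_scale_fun)

lemma sweedler_hom: "(\<And>x y. h (x + y) = h x + h y) \<Longrightarrow> h (sweedler b F) = sweedler b (\<lambda>x y. h (F x y))"
  by (simp add: sweedler_def tensor_lift_hom)

lemma sweedler_lin: "lin_on sV sW UNIV h \<Longrightarrow> h (sweedler b F) = sweedler b (\<lambda>x y. h (F x y))"
  by (rule sweedler_hom) (simp add: lin_on_def)

lemma sweedler_0: "sweedler b (\<lambda>x y. 0) = 0"
  by (simp add: sweedler_def tensor_lift_decomp case_prod_unfold)

lemma sweedler_swap:
  "sweedler a (\<lambda>x y. sweedler b (\<lambda>u v. F x y u v)) = sweedler b (\<lambda>u v. sweedler a (\<lambda>x y. F x y u v))"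
  unfolding sweedler_def by (rule tensor_lift_swap)

lemma sweedler_dual_swap:
  "sweedler a (\<lambda>x y. dual_sweedler \<beta> (\<lambda>u v. F x y u v)) = dual_sweedler \<beta> (\<lambda>u v. sweedler a (\<lambda>x y. F x y u v))"
  unfolding sweedler_def dual_sweedler_def by (rule tensor_lift_swap)

lemma lin_on_sweedler_fun:
  "\<lbrakk>vector_space sW; \<And>x y. lin_on sU sW U (\<lambda>u. F u x y)\<rbrakk> \<Longrightarrow> lin_on sU sW U (\<lambda>u. sweedler b (F u))"
  unfolding sweedler_def by (rule lin_on_tensor_lift_fun[OF comult_in])

lemma lin_on_comult: "lin_on scale fscale UNIV comult"
  using comult_linear linear_iff_lin_on[OF vector_space_axioms vector_space_fscale] by blast

lemma lin_on_sweedler: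
  assumes "vector_space sW" "bilin_on scale scale sW UNIV UNIV F"
  shows "lin_on scale sW UNIV (\<lambda>b. sweedler b F)"
  unfolding sweedler_def
  by (rule lin_on_compose[OF BB.lin_on_tensor_lift[OF assms] lin_on_comult comult_in])

lemma lin_antipode: "lin antipode"
  using antipode_linear linear_iff_lin_on[OF vector_space_axioms vector_space_axioms] by blast

lemmas lin_simps = distrib_left distrib_right scale_mult_left scale_mult_right scale_right_distrib
  scale_left_distrib sweedler_add_fun
  sweedler_scale_fun[OF vector_space_axioms] sweedler_scale_fun[OF vector_space_field]
  sweedler_scale_fun[OF vector_space_fscale] lin_on_add[OF lin_antipode UNIV_I UNIV_I]
  lin_on_scale[OF lin_antipode UNIV_I]

text \<open>\<open>coassoc\<close> is one identity in (B \<otimes> B) \<otimes> B. A trilinear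
  \<open>F\<close> induces a linear map \<open>h\<close> on that space by two nested lifts, and
  applying \<open>h\<close> to both sides of the axiom yields the equation.\<close>

lemma sweedler_coassoc:
  assumes W: "vector_space sW"
    and F1: "\<And>v w. lin_on scale sW UNIV (\<lambda>u. F u v w)"
    and F2: "\<And>u w. lin_on scale sW UNIV (\<lambda>v. F u v w)"
    and F3: "\<And>u v. lin_on scale sW UNIV (\<lambda>w. F u v w)"
  shows "sweedler b (\<lambda>x w. sweedler x (\<lambda>u v. F u v w)) = sweedler b (\<lambda>u y. sweedler y (\<lambda>v w. F u v w))"
proof -
  let ?T = "tensor_space scale scale UNIV UNIV"
  define G where "G = (\<lambda>t w. tensor_lift scale scale UNIV UNIV t (\<lambda>u v. F u v w))"
  define h where "h = (\<lambda>t. tensor_lift fscale scale ?T UNIV t G)"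
  have bil: "bilin_on scale scale sW UNIV UNIV (\<lambda>u v. F u v w)" for w
    by (intro bilin_onI F1 F2)
  have G: "bilin_on fscale scale sW ?T UNIV G"
    unfolding G_def by (intro bilin_onI BB.lin_on_tensor_lift[OF W bil] lin_on_tensor_lift_fun[OF _ W] F3)
  have h: "lin_on fscale sW (tensor_space fscale scale ?T UNIV) h"
    unfolding h_def by (rule BBB.lin_on_tensor_lift[OF W G])
  have in_T: "pure_tensor scale scale u v \<in> ?T" for u v
    by (rule BB.pure_in_tensor_space) auto
  have in_TB: "pure_tensor fscale scale (pure_tensor scale scale u v) w \<in> tensor_space fscale scale ?T UNIV" for u v w
    by (rule BBB.pure_in_tensor_space) (auto simp: in_T)
  have h_pure: "h (pure_tensor fscale scale (pure_tensor scale scale u v) w) = F u v w" for u v w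
    unfolding h_def
    by (subst BBB.tensor_lift_pure[OF W G in_T]) (simp_all add: G_def BB.tensor_lift_pure[OF W bil])
  note sub = BBB.subspace_tensor_space
  note hom = tensor_lift_lin_hom[OF sub vector_space_fscale W comult_in _ h]
  note mem = tensor_lift_mem[OF sub vector_space_fscale comult_in]
  have "sweedler b (\<lambda>x w. sweedler x (\<lambda>u v. F u v w)) =
      h (sweedler b (\<lambda>x w. sweedler x (\<lambda>u v. pure_tensor fscale scale (pure_tensor scale scale u v) w)))"
    unfolding sweedler_def by (simp add: hom mem in_TB h_pure)
  also have "\<dots> = h (sweedler b (\<lambda>u y. sweedler y (\<lambda>v w. pure_tensor fscale scale (pure_tensor scale scale u v) w)))"
    unfolding sweedler_def by (simp only: coassoc)
  also have "\<dots> = sweedler b (\<lambda>u y. sweedler y (\<lambda>v w. F u v w))"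
    unfolding sweedler_def by (simp add: hom mem in_TB h_pure)
  finally show ?thesis .
qed

lemma sweedler_counit_left:
  assumes "lin_on scale sW UNIV F"
  shows "sweedler b (\<lambda>x y. sW (counit x) (F y)) = F b"
proof -
  have "F b = F (sweedler b (\<lambda>x y. scale (counit x) y))"
    using counit_left by (simp add: sweedler_def)
  also have "\<dots> = sweedler b (\<lambda>x y. sW (counit x) (F y))"
    by (simp add: sweedler_lin[OF assms] lin_on_scale[OF assms])
  finally show ?thesis ..
qed

lemma sweedler_counit_right:
  assumes "lin_on scale sW UNIV F"
  shows "sweedler b (\<lambda>x y. sW (counit y) (F x)) = F b"
proof -
  have "F b = F (sweedler b (\<lambda>x y. scale (counit y) x))"
    using counit_right by (simp add: sweedler_def)
  also have "\<dots> = sweedler b (\<lambda>x y. sW (counit y) (F x))"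
    by (simp add: sweedler_lin[OF assms] lin_on_scale[OF assms])
  finally show ?thesis ..
qed

lemma sweedler_antipode_left:
  assumes "lin_on scale sW UNIV F"
  shows "sweedler b (\<lambda>x y. F (antipode x * y)) = sW (counit b) (F 1)"
  using sweedler_lin[OF assms, of b "\<lambda>x y. antipode x * y"] antipode_left[of b]
  by (simp add: sweedler_def[symmetric] lin_on_scale[OF assms])

lemma sweedler_antipode_right:
  assumes "lin_on scale sW UNIV F"
  shows "sweedler b (\<lambda>x y. F (x * antipode y)) = sW (counit b) (F 1)"
  using sweedler_lin[OF assms, of b "\<lambda>x y. x * antipode y"] antipode_right[of b]
  by (simp add: sweedler_def[symmetric] lin_on_scale[OF assms])

lemma sweedler_mult:
  assumes W: "vector_space sW" and F: "bilin_on scale scale sW UNIV UNIV F"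
  shows "sweedler (a * b) F = sweedler a (\<lambda>a' a''. sweedler b (\<lambda>b' b''. F (a' * b') (a'' * b'')))"
proof -
  have pure: "pure_tensor scale scale u v \<in> tensor_space scale scale UNIV UNIV" for u v
    by (rule BB.pure_in_tensor_space) auto
  note sub = BB.subspace_tensor_space
  note hom = tensor_lift_lin_hom[OF sub vector_space_fscale W comult_in _ BB.lin_on_tensor_lift[OF W F]]
  note mem = tensor_lift_mem[OF sub vector_space_fscale comult_in]
  show ?thesis
    unfolding sweedler_def comult_mult by (simp add: hom mem pure BB.tensor_lift_pure[OF W F])
qed

lemma sweedler_one:
  assumes "vector_space sW" "bilin_on scale scale sW UNIV UNIV F"
  shows "sweedler 1 F = F 1 1"
  unfolding sweedler_def comult_one by (rule BB.tensor_lift_pure[OF assms]) auto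

lemma antipode_1: "antipode 1 = 1"
proof -
  have "sweedler 1 (\<lambda>x y. antipode x * y) = antipode 1 * 1"
    by (rule sweedler_one[OF vector_space_axioms]) (simp add: bilin_on_def lin_on_def lin_simps)
  then show ?thesis
    using antipode_left[of 1] by (simp add: sweedler_def counit_one)
qed

text \<open>
  Both sides are convolution inverses of the product \<open>B \<otimes> B \<rightarrow> B\<close>; here \<open>Q\<close> is the convolution product
  of the two with the product of \<open>B\<close> in between.
\<close>

lemma antipode_mult: "antipode (a * b) = antipode b * antipode a"
proof -
  note vs = vector_space_axioms
  define Q where "Q = sweedler a (\<lambda>a1 r. sweedler r (\<lambda>a2 a3. sweedler b (\<lambda>b1 s. sweedler s (\<lambda>b2 b3.
    antipode (a1 * b1) * ((a2 * b2) * (antipode b3 * antipode a3))))))"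
  \<comment> \<open>First evaluation of \<open>Q\<close>: the right antipode law removes
    \<open>b2\<close> with \<open>b3\<close>, then \<open>a2\<close> with \<open>a3\<close>, and the
    counits restore \<open>b\<close> and \<open>a\<close>.\<close>
  have "sweedler b (\<lambda>b1 s. sweedler s (\<lambda>b2 b3.
      antipode (a1 * b1) * ((a2 * b2) * (antipode b3 * antipode a3)))) =
      antipode (a1 * b) * (a2 * antipode a3)" for a1 a2 a3
  proof -
    have "sweedler s (\<lambda>b2 b3. antipode (a1 * b1) * ((a2 * b2) * (antipode b3 * antipode a3))) =
        scale (counit s) (antipode (a1 * b1) * (a2 * antipode a3))" for b1 s
      using sweedler_antipode_right[of scale "\<lambda>x. antipode (a1 * b1) * (a2 * (x * antipode a3))" s]
      by (simp add: lin_on_def lin_simps mult.assoc)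
    then show ?thesis
      using sweedler_counit_right[of scale "\<lambda>x. antipode (a1 * x) * (a2 * antipode a3)" b]
      by (simp add: lin_on_def lin_simps)
  qed
  then have "Q = sweedler a (\<lambda>a1 r. sweedler r (\<lambda>a2 a3. antipode (a1 * b) * (a2 * antipode a3)))"
    by (simp add: Q_def)
  also have "\<dots> = sweedler a (\<lambda>a1 r. scale (counit r) (antipode (a1 * b)))"
    using sweedler_antipode_right[of scale "\<lambda>x. antipode (_ * b) * x"] by (simp add: lin_on_def lin_simps)
  also have "\<dots> = antipode (a * b)"
    by (rule sweedler_counit_right) (simp add: lin_on_def lin_simps)
  finally have 1: "Q = antipode (a * b)" .
  \<comment> \<open>Second evaluation of \<open>Q\<close>: the first two components of
    \<open>a\<close> and of \<open>b\<close> are grouped, so that \<open>antipode (a1 * b1)\<close>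
    meets \<open>a2 * b2\<close>.\<close>
  have "Q = sweedler a (\<lambda>r a3. sweedler r (\<lambda>a1 a2. sweedler b (\<lambda>b1 s. sweedler s (\<lambda>b2 b3.
      antipode (a1 * b1) * ((a2 * b2) * (antipode b3 * antipode a3))))))"
    unfolding Q_def by (rule sweedler_coassoc[OF vs, symmetric]; simp add: lin_on_def lin_simps)
  also have "\<dots> = sweedler a (\<lambda>r a3. sweedler r (\<lambda>a1 a2. sweedler b (\<lambda>s b3. sweedler s (\<lambda>b1 b2.
      antipode (a1 * b1) * ((a2 * b2) * (antipode b3 * antipode a3))))))"
  proof -
    have "sweedler b (\<lambda>b1 s. sweedler s (\<lambda>b2 b3. antipode (a1 * b1) * ((a2 * b2) * (antipode b3 * antipode a3)))) =
        sweedler b (\<lambda>s b3. sweedler s (\<lambda>b1 b2. antipode (a1 * b1) * ((a2 * b2) * (antipode b3 * antipode a3))))"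
      for a1 a2 a3
      by (rule sweedler_coassoc[OF vs, symmetric]; simp add: lin_on_def lin_simps)
    then show ?thesis by simp
  qed
  also have "\<dots> = sweedler a (\<lambda>r a3. sweedler b (\<lambda>s b3. sweedler r (\<lambda>a1 a2. sweedler s (\<lambda>b1 b2.
      antipode (a1 * b1) * (a2 * b2) * (antipode b3 * antipode a3)))))"
    by (subst (2) sweedler_swap) (simp add: mult.assoc)
  also have "\<dots> = sweedler a (\<lambda>r a3. sweedler b (\<lambda>s b3. scale (counit (r * s)) (antipode b3 * antipode a3)))"
  proof -
    \<comment> \<open>Read backwards, \<open>sweedler_mult\<close> turns the double sum into one
      over the coproduct of \<open>r * s\<close>, to which the left antipode law applies.\<close>
    have "sweedler r (\<lambda>a1 a2. sweedler s (\<lambda>b1 b2. antipode (a1 * b1) * (a2 * b2) * z)) =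
        scale (counit (r * s)) z" for r s z
      using sweedler_antipode_left[of scale "\<lambda>x. x * z" "r * s"]
      by (subst sweedler_mult[OF vs, symmetric]) (simp_all add: bilin_on_def lin_on_def lin_simps)
    then show ?thesis by simp
  qed
  also have "\<dots> = sweedler a (\<lambda>r a3. scale (counit r) (sweedler b (\<lambda>s b3. scale (counit s) (antipode b3 * antipode a3))))"
    by (simp add: counit_mult lin_simps flip: scale_scale)
  also have "\<dots> = sweedler a (\<lambda>r a3. scale (counit r) (antipode b * antipode a3))"
    using sweedler_counit_left[of scale "\<lambda>x. antipode x * antipode _"] by (simp add: lin_on_def lin_simps)
  also have "\<dots> = antipode b * antipode a"
    by (rule sweedler_counit_left) (simp add: lin_on_def lin_simps)
  finally show ?thesis using 1 by simp
qed

section \<open>The product of the finite dual\<close>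

lemma dual_mult_add_left: "(\<alpha> + \<beta>) \<star> \<gamma> = \<alpha> \<star> \<gamma> + \<beta> \<star> \<gamma>"
  and dual_mult_add_right: "\<alpha> \<star> (\<beta> + \<gamma>) = \<alpha> \<star> \<beta> + \<alpha> \<star> \<gamma>"
  and dual_mult_scale_left: "fscale c \<alpha> \<star> \<beta> = fscale c (\<alpha> \<star> \<beta>)"
  and dual_mult_scale_right: "\<alpha> \<star> fscale c \<beta> = fscale c (\<alpha> \<star> \<beta>)"
  by (simp_all add: dual_mult_def fun_eq_iff fun_simps distrib_left distrib_right sweedler_add_fun
      sweedler_scale_fun[OF vector_space_field] mult.assoc mult.left_commute)

lemmas dual_mult_lin = dual_mult_add_left dual_mult_add_right dual_mult_scale_left dual_mult_scale_right

lemma bilin_functionals: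
  "\<lbrakk>functional \<alpha>; functional \<beta>\<rbrakk> \<Longrightarrow> bilin_on scale scale (*) UNIV UNIV (\<lambda>x y. \<alpha> x * \<beta> y)"
  by (simp add: bilin_on_def lin_on_def algebra_simps)

lemma functional_dual_mult: "\<lbrakk>functional \<alpha>; functional \<beta>\<rbrakk> \<Longrightarrow> functional (\<alpha> \<star> \<beta>)"
  unfolding dual_mult_def by (intro lin_on_sweedler vector_space_field bilin_functionals)

lemma dual_mult_assoc:
  assumes "functional \<alpha>" "functional \<beta>" "functional \<gamma>"
  shows "(\<alpha> \<star> \<beta>) \<star> \<gamma> = \<alpha> \<star> (\<beta> \<star> \<gamma>)"
proof
  fix x
  have "((\<alpha> \<star> \<beta>) \<star> \<gamma>) x = sweedler x (\<lambda>y w. sweedler y (\<lambda>u v. \<alpha> u * \<beta> v * \<gamma> w))"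
    unfolding dual_mult_def by (simp add: sweedler_hom[of "\<lambda>x. x * _"] distrib_right)
  also have "\<dots> = sweedler x (\<lambda>u y. sweedler y (\<lambda>v w. \<alpha> u * \<beta> v * \<gamma> w))"
    by (rule sweedler_coassoc[OF vector_space_field])
      (use assms in \<open>simp_all add: lin_on_def algebra_simps\<close>)
  also have "\<dots> = (\<alpha> \<star> (\<beta> \<star> \<gamma>)) x"
    unfolding dual_mult_def by (simp add: sweedler_scale_fun[OF vector_space_field] mult.assoc)
  finally show "((\<alpha> \<star> \<beta>) \<star> \<gamma>) x = (\<alpha> \<star> (\<beta> \<star> \<gamma>)) x" .
qed

lemma dual_mult_counit_right: "functional \<alpha> \<Longrightarrow> \<alpha> \<star> counit = \<alpha>"
  unfolding dual_mult_def
  using sweedler_counit_right[of "(*)" \<alpha>] by (simp add: mult.commute)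

text \<open>Both factors expand in their dual bases, so \<open>p \<star> q\<close> is a finite
  linear combination of products \<open>\<phi> \<star> \<psi>\<close>. This reduces the conditions
  that define the ideal for a product of functionals to finitely many.\<close>

lemma dual_mult_vanish:
  assumes ps: "dual_basis_mod I ps" and p: "functional p" "\<And>x. x \<in> I \<Longrightarrow> p x = 0"
    and qs: "dual_basis_mod J qs" and q: "functional q" "\<And>x. x \<in> J \<Longrightarrow> q x = 0"
    and x: "\<And>\<phi> \<psi>. \<lbrakk>\<phi> \<in> fst ` set ps; \<psi> \<in> fst ` set qs\<rbrakk> \<Longrightarrow> (\<phi> \<star> \<psi>) x = 0"
  shows "(p \<star> q) x = 0"
proof -
  have expand: "r = (\<Sum>(\<phi>, e)\<leftarrow>rs. fscale (r e) \<phi>)"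
    if "dual_basis_mod K rs" "functional r" "\<And>x. x \<in> K \<Longrightarrow> r x = 0" for r rs K
  proof
    fix x
    have "r x = (\<Sum>(\<phi>, e)\<leftarrow>rs. \<phi> x * r e)"
      by (rule dual_basis_mod_expand[OF that])
    also have "\<dots> = (\<Sum>(\<phi>, e)\<leftarrow>rs. fscale (r e) \<phi>) x"
      by (simp add: sum_list_fun_apply case_prod_unfold fscale_apply mult.commute)
    finally show "r x = (\<Sum>(\<phi>, e)\<leftarrow>rs. fscale (r e) \<phi>) x" .
  qed
  have q0: "(\<phi> \<star> q) x = 0" if "\<phi> \<in> fst ` set ps" for \<phi>
  proof -
    have "(\<phi> \<star> (\<Sum>(\<psi>, e)\<leftarrow>rs. fscale (q e) \<psi>)) x = 0" if "\<forall>\<psi>\<in>fst ` set rs. (\<phi> \<star> \<psi>) x = 0" for rs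
    proof -
      have "\<phi> \<star> 0 = 0"
        using dual_mult_add_right[of \<phi> 0 0] by simp
      then have "(\<phi> \<star> (\<Sum>(\<psi>, e)\<leftarrow>rs. fscale (q e) \<psi>)) x = (\<Sum>(\<psi>, e)\<leftarrow>rs. q e * (\<phi> \<star> \<psi>) x)"
        by (subst sum_list_hom[of "\<lambda>\<beta>. \<phi> \<star> \<beta>"])
          (simp_all add: dual_mult_lin case_prod_unfold sum_list_fun_apply fscale_apply)
      also have "\<dots> = (\<Sum>(\<psi>, e)\<leftarrow>rs. 0)"
        using that by (intro arg_cong[of _ _ sum_list] map_cong) auto
      finally show ?thesis by (simp add: case_prod_unfold)
    qed
    then have "(\<phi> \<star> (\<Sum>(\<psi>, e)\<leftarrow>qs. fscale (q e) \<psi>)) x = 0"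
      using x[OF that] by blast
    moreover have "q = (\<Sum>(\<psi>, e)\<leftarrow>qs. fscale (q e) \<psi>)"
      by (rule expand[OF qs q])
    ultimately show ?thesis by (rule back_subst[OF _ sym, where P = "\<lambda>r. (\<phi> \<star> r) x = 0"])
  qed
  have "((\<Sum>(\<phi>, e)\<leftarrow>rs. fscale (p e) \<phi>) \<star> q) x = 0" if "\<forall>\<phi>\<in>fst ` set rs. (\<phi> \<star> q) x = 0" for rs
  proof -
    have "0 \<star> q = 0"
      using dual_mult_add_left[of 0 0 q] by simp
    then have "((\<Sum>(\<phi>, e)\<leftarrow>rs. fscale (p e) \<phi>) \<star> q) x = (\<Sum>(\<phi>, e)\<leftarrow>rs. p e * (\<phi> \<star> q) x)"
      by (subst sum_list_hom[of "\<lambda>\<beta>. \<beta> \<star> q"])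
        (simp_all add: dual_mult_lin case_prod_unfold sum_list_fun_apply fscale_apply)
    also have "\<dots> = (\<Sum>(\<phi>, e)\<leftarrow>rs. 0)"
      using that by (intro arg_cong[of _ _ sum_list] map_cong) auto
    finally show ?thesis by (simp add: case_prod_unfold)
  qed
  then have "((\<Sum>(\<phi>, e)\<leftarrow>ps. fscale (p e) \<phi>) \<star> q) x = 0"
    using q0 by blast
  moreover have "p = (\<Sum>(\<phi>, e)\<leftarrow>ps. fscale (p e) \<phi>)"
    by (rule expand[OF ps p])
  ultimately show ?thesis by (rule back_subst[OF _ sym, where P = "\<lambda>r. (r \<star> q) x = 0"])
qed

text \<open>
  If \<open>\<alpha>\<close> and \<open>\<beta>\<close> vanish on \<open>I\<close> and \<open>J\<close>, then \<open>\<alpha> \<star> \<beta>\<close> vanishes on the preimage under the coproduct of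
  \<open>I \<otimes> B + B \<otimes> J\<close>, here described by the functionals that it annihilates.
\<close>

lemma dual_mult_fdual:
  assumes "\<alpha> \<in> fdual" "\<beta> \<in> fdual"
  shows "\<alpha> \<star> \<beta> \<in> fdual"
proof -
  obtain I where I: "functional \<alpha>" "two_sided_ideal I" "finite_codimension I" "\<And>x. x \<in> I \<Longrightarrow> \<alpha> x = 0"
    using assms(1) fdualE by blast
  obtain J where J: "functional \<beta>" "two_sided_ideal J" "finite_codimension J" "\<And>x. x \<in> J \<Longrightarrow> \<beta> x = 0"
    using assms(2) fdualE by blast
  obtain ps where ps: "dual_basis_mod I ps"
    using dual_basis_mod_exists[OF two_sided_idealD(1)[OF I(2)] I(3)] by auto
  obtain qs where qs: "dual_basis_mod J qs"
    using dual_basis_mod_exists[OF two_sided_idealD(1)[OF J(2)] J(3)] by auto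
  define P where "P = {p. functional p \<and> (\<forall>x\<in>I. p x = 0)}"
  define Q where "Q = {q. functional q \<and> (\<forall>x\<in>J. q x = 0)}"
  define K where "K = {x. \<forall>r\<in>(\<lambda>(p, q). p \<star> q) ` (P \<times> Q). r x = 0}"
  have P: "functional p" "(\<lambda>x. p (b * x)) \<in> P" "(\<lambda>x. p (x * b)) \<in> P" if "p \<in> P" for p b
    using that I(2) by (auto simp: P_def functional_mult two_sided_ideal_def)
  have Q: "functional q" "(\<lambda>x. q (b * x)) \<in> Q" "(\<lambda>x. q (x * b)) \<in> Q" if "q \<in> Q" for q b
    using that J(2) by (auto simp: Q_def functional_mult two_sided_ideal_def)
  have K: "(p \<star> q) x = 0" if "x \<in> K" "p \<in> P" "q \<in> Q" for p q x
    using that by (auto simp: K_def)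
  have "subspace K"
    unfolding K_def by (rule subspace_kernels) (auto intro!: functional_dual_mult intro: P(1) Q(1))
  moreover have "b * x \<in> K" "x * b \<in> K" if "x \<in> K" for x b
  proof -
    have "(p \<star> q) (b * x) = 0" "(p \<star> q) (x * b) = 0" if "p \<in> P" "q \<in> Q" for p q
    proof -
      note mult = sweedler_mult[OF vector_space_field bilin_functionals[OF P(1)[OF that(1)] Q(1)[OF that(2)]]]
      \<comment> \<open>Multiplicativity of the coproduct distributes \<open>b\<close> over both
        factors. \<open>P\<close> and \<open>Q\<close> are stable under these translations because
        \<open>I\<close> and \<open>J\<close> are two-sided, so each summand vanishes at
        \<open>x\<close>.\<close>
      have "(p \<star> q) (b * x) = sweedler b (\<lambda>b' b''. ((\<lambda>x. p (b' * x)) \<star> (\<lambda>x. q (b'' * x))) x)"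
        by (simp add: dual_mult_def mult)
      then show "(p \<star> q) (b * x) = 0"
        by (simp add: K[OF \<open>x \<in> K\<close> P(2)[OF that(1)] Q(2)[OF that(2)]] sweedler_0)
      have "(p \<star> q) (x * b) = sweedler b (\<lambda>b' b''. ((\<lambda>x. p (x * b')) \<star> (\<lambda>x. q (x * b''))) x)"
        unfolding dual_mult_def mult by (rule sweedler_swap)
      then show "(p \<star> q) (x * b) = 0"
        by (simp add: K[OF \<open>x \<in> K\<close> P(3)[OF that(1)] Q(3)[OF that(2)]] sweedler_0)
    qed
    then show "b * x \<in> K" "x * b \<in> K"
      by (auto simp: K_def)
  qed
  ultimately have "two_sided_ideal K"
    by (auto simp: two_sided_ideal_def)
  moreover have "finite_codimension K"
  proof (rule finite_codimension_mono)
    let ?\<Phi> = "(\<lambda>(p, q). p \<star> q) ` (fst ` set ps \<times> fst ` set qs)"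
    show "finite_codimension {x. \<forall>r\<in>?\<Phi>. r x = 0}"
      using ps qs by (intro finite_codimension_kernels)
        (auto simp: dual_basis_mod_def intro!: functional_dual_mult)
    show "{x. \<forall>r\<in>?\<Phi>. r x = 0} \<subseteq> K"
    proof
      fix x assume x: "x \<in> {x. \<forall>r\<in>?\<Phi>. r x = 0}"
      have "(p \<star> q) x = 0" if "p \<in> P" "q \<in> Q" for p q
        by (rule dual_mult_vanish[OF ps _ _ qs]) (use that x in \<open>auto simp: P_def Q_def\<close>)
      then show "x \<in> K" by (auto simp: K_def)
    qed
  qed
  moreover have "\<alpha> \<in> P" "\<beta> \<in> Q"
    using I J by (auto simp: P_def Q_def)
  ultimately show ?thesis
    by (intro fdualI[of _ K] functional_dual_mult I(1) J(1)) (auto simp: K)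
qed

text \<open>The ideal is the preimage of one killed by \<open>\<beta>\<close>: reversing products
  only swaps left and right multiples, and the functionals \<open>\<phi>\<close> composed with
  \<open>T\<close> bound its codimension. The intended \<open>T\<close> is the inverse
  antipode.\<close>

lemma fdual_antihom:
  assumes \<beta>: "\<beta> \<in> fdual" and T: "lin T" "\<And>x y. T (x * y) = T y * T x"
  shows "(\<lambda>x. \<beta> (T x)) \<in> fdual"
proof -
  obtain I where I: "functional \<beta>" "two_sided_ideal I" "finite_codimension I" "\<And>x. x \<in> I \<Longrightarrow> \<beta> x = 0"
    using \<beta> fdualE by blast
  obtain ps where ps: "dual_basis_mod I ps"
    using dual_basis_mod_exists[OF two_sided_idealD(1)[OF I(2)] I(3)] by auto
  have fn: "functional (\<lambda>x. \<phi> (T x))" if "functional \<phi>" for \<phi>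
    by (rule lin_on_compose[OF that T(1)]) auto
  let ?\<Phi> = "(\<lambda>(\<phi>, e) x. \<phi> (T x)) ` set ps"
  show ?thesis
  proof (rule fdualI)
    show "two_sided_ideal {x. T x \<in> I}"
      using I(2) T by (auto simp: two_sided_ideal_def subspace_def lin_on_def)
        (metis scale_zero_left)
    have "T x \<in> I" if "\<forall>r\<in>?\<Phi>. r x = 0" for x
    proof -
      have "(\<Sum>(\<phi>, e)\<leftarrow>ps. scale (\<phi> (T x)) e) = (\<Sum>(\<phi>, e)\<leftarrow>ps. 0)"
        using that by (intro arg_cong[of _ _ sum_list] map_cong) auto
      moreover have "T x - (\<Sum>(\<phi>, e)\<leftarrow>ps. scale (\<phi> (T x)) e) \<in> I"
        using ps by (simp add: dual_basis_mod_def)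
      ultimately show ?thesis by (simp add: case_prod_unfold)
    qed
    moreover have "finite_codimension {x. \<forall>r\<in>?\<Phi>. r x = 0}"
      using ps by (intro finite_codimension_kernels) (auto simp: dual_basis_mod_def intro!: fn)
    ultimately show "finite_codimension {x. T x \<in> I}"
      by (rule_tac finite_codimension_mono) auto
  qed (use I fn in auto)
qed

end


section \<open>Braided commutativity of the Heisenberg double\<close>

lemma lin_on_id: "lin_on sU sU U (\<lambda>u. u)"
  by (simp add: lin_on_def)

lemma lin_on_eval: "lin_on fscale (*) U (\<lambda>u. u z)"
  by (simp add: lin_on_def fun_simps)

lemma lin_on_fscale_right: "lin_on sU fscale U g \<Longrightarrow> lin_on sU fscale U (\<lambda>u. fscale (k :: 'k::field) (g u))"
  by (auto simp: lin_on_def fscale_add fscale_fscale mult.commute)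

lemma lin_on_fscale_left: "lin_on sU (*) U g \<Longrightarrow> lin_on sU fscale U (\<lambda>u. fscale (g u :: 'k::field) X)"
  by (auto simp: lin_on_def fscale_add_left fscale_fscale)

locale bijective_hopf_algebra = hopf_algebra scale comult counit antipode
  for scale :: "'k::field \<Rightarrow> 'b::ring_1 \<Rightarrow> 'b"
    and comult :: "'b \<Rightarrow> ('b, 'b, 'k) tensor" and counit :: "'b \<Rightarrow> 'k" and antipode :: "'b \<Rightarrow> 'b" +
  assumes bij_antipode: "bij antipode"
begin

interpretation double: tensor_factors fscale scale fdual UNIV
  by (rule tensor_factors.intro[OF vector_space_fscale vector_space_axioms subspace_fdual subspace_UNIV])

lemma subspace_double_space: "module.subspace fscale double_space"
  unfolding double_space_def by (rule double.subspace_tensor_space)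

interpretation double2: tensor_factors fscale fscale double_space double_space
  by (rule tensor_factors.intro[OF vector_space_fscale vector_space_fscale subspace_double_space subspace_double_space])

section \<open>The inverse antipode and its dual\<close>

abbreviation antipode_inv where "antipode_inv \<equiv> inv antipode"

lemma antipode_antipode_inv [simp]: "antipode (antipode_inv x) = x"
  and antipode_inv_antipode [simp]: "antipode_inv (antipode x) = x"
  using bij_antipode by (simp_all add: bij_def surj_f_inv_f)

lemma antipode_inv_eqI: "antipode y = x \<Longrightarrow> antipode_inv x = y"
  by auto

lemma lin_antipode_inv: "lin antipode_inv"
  by (intro lin_onI antipode_inv_eqI) (simp_all add: lin_simps)

lemma antipode_inv_mult: "antipode_inv (x * y) = antipode_inv y * antipode_inv x"
  by (rule antipode_inv_eqI) (simp add: antipode_mult)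

lemma antipode_inv_1: "antipode_inv 1 = 1"
  by (rule antipode_inv_eqI) (rule antipode_1)

text \<open>Applying the anti-multiplicative \<open>antipode_inv\<close> to
  \<open>x * antipode y\<close> gives \<open>y * antipode_inv x\<close>, so the right antipode law
  becomes a law for the inverse with the components in reversed order.\<close>

lemma sweedler_antipode_inv:
  assumes "lin_on scale sW UNIV F"
  shows "sweedler b (\<lambda>x y. F (y * antipode_inv x)) = sW (counit b) (F 1)"
proof -
  have "y * antipode_inv x = antipode_inv (x * antipode y)" for x y
    by (simp add: antipode_inv_mult)
  moreover have "lin_on scale sW UNIV (\<lambda>x. F (antipode_inv x))"
    by (rule lin_on_compose[OF assms lin_antipode_inv]) auto
  ultimately show ?thesis
    using sweedler_antipode_right[of sW "\<lambda>x. F (antipode_inv x)" b] by (simp add: antipode_inv_1)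
qed

text \<open>The inverse of \<open>dual_antipode\<close> as a total map.
  \<open>dual_antipode_inv\<close> is an \<open>inv_into\<close> and is guaranteed to have this form
  only on \<open>fdual\<close>; the total version is linear without side conditions.\<close>

definition coantipode_inv :: "('b \<Rightarrow> 'k) \<Rightarrow> 'b \<Rightarrow> 'k"
  where "coantipode_inv \<beta> = (\<lambda>x. \<beta> (antipode_inv x))"

text \<open>For \<open>\<beta>\<close> in \<open>fdual\<close> this is
  \<open>b \<rightharpoonup> \<beta>\<close>, in a form free of the choice behind
  \<open>dual_sweedler\<close> and linear in \<open>\<beta>\<close> on all functions.\<close>

definition translate :: "'b \<Rightarrow> ('b \<Rightarrow> 'k) \<Rightarrow> 'b \<Rightarrow> 'k"
  where "translate b \<beta> = (\<lambda>x. \<beta> (x * b))"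

lemma coantipode_inv_fdual: "\<beta> \<in> fdual \<Longrightarrow> coantipode_inv \<beta> \<in> fdual"
  unfolding coantipode_inv_def by (rule fdual_antihom[OF _ lin_antipode_inv antipode_inv_mult])

lemma dual_antipode_inv_eq:
  assumes "\<beta> \<in> fdual"
  shows "dual_antipode_inv \<beta> = coantipode_inv \<beta>"
  unfolding dual_antipode_inv_def
proof (rule inv_into_f_eq)
  show "inj_on dual_antipode fdual"
    unfolding dual_antipode_def inj_on_def fun_eq_iff by (metis antipode_antipode_inv)
qed (use assms coantipode_inv_fdual in \<open>auto simp: dual_antipode_def coantipode_inv_def\<close>)

lemma translate_fdual: "\<beta> \<in> fdual \<Longrightarrow> translate b \<beta> \<in> fdual"
  unfolding translate_def by (rule fdual_mult)

lemma act_on_dual_translate: "\<beta> \<in> fdual \<Longrightarrow> b \<rightharpoonup> \<beta> = translate b \<beta>"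
  unfolding translate_def by (rule act_on_dual_eq)

lemma translate_1: "translate 1 \<beta> = \<beta>"
  by (simp add: translate_def)

section \<open>Linearity of Sweedler expressions\<close>

lemma lin_on_coantipode_inv: "lin_on sU fscale U g \<Longrightarrow> lin_on sU fscale U (\<lambda>u. coantipode_inv (g u))"
  by (auto simp: lin_on_def coantipode_inv_def fun_eq_iff fun_simps)

lemma lin_on_translate: "lin_on sU fscale U g \<Longrightarrow> lin_on sU fscale U (\<lambda>u. translate b (g u))"
  by (auto simp: lin_on_def translate_def fun_eq_iff fun_simps)

lemma lin_on_translate_left:
  "\<lbrakk>functional \<beta>; lin_on sU scale U g\<rbrakk> \<Longrightarrow> lin_on sU fscale U (\<lambda>u. translate (g u) \<beta>)"
  by (auto simp: lin_on_def translate_def fun_eq_iff fun_simps distrib_left scale_mult_right)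

lemma lin_on_dual_mult_left: "lin_on sU fscale U g \<Longrightarrow> lin_on sU fscale U (\<lambda>u. g u \<star> \<beta>)"
  and lin_on_dual_mult_right: "lin_on sU fscale U g \<Longrightarrow> lin_on sU fscale U (\<lambda>u. \<beta> \<star> g u)"
  by (auto simp: lin_on_def dual_mult_lin)

lemma lin_on_smash_left: "lin_on sU fscale U g \<Longrightarrow> lin_on sU fscale U (\<lambda>u. g u \<sharp> b)"
  and lin_on_smash_right: "lin_on sU scale U h \<Longrightarrow> lin_on sU fscale U (\<lambda>u. \<beta> \<sharp> h u)"
  by (auto simp: lin_on_def smash_def double.pure_tensor_add_left double.pure_tensor_add_right
      double.pure_tensor_scale_left double.pure_tensor_scale_right)

lemma lin_on_mult_left: "lin_on sU scale U g \<Longrightarrow> lin_on sU scale U (\<lambda>u. g u * b)"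
  and lin_on_mult_right: "lin_on sU scale U g \<Longrightarrow> lin_on sU scale U (\<lambda>u. b * g u)"
  and lin_on_antipode: "lin_on sU scale U g \<Longrightarrow> lin_on sU scale U (\<lambda>u. antipode (g u))"
  by (auto simp: lin_on_def lin_simps)

lemma lin_on_sweedler_arg:
  assumes "lin_on sU scale U g" "bilin_on scale scale fscale UNIV UNIV F"
  shows "lin_on sU fscale U (\<lambda>u. sweedler (g u) F)"
  by (rule lin_on_compose[OF lin_on_sweedler[OF vector_space_fscale assms(2)] assms(1)]) auto

lemma lin_on_dual_sweedler_fun:
  "\<lbrakk>\<beta> \<in> fdual; \<And>x y. \<lbrakk>x \<in> fdual; y \<in> fdual\<rbrakk> \<Longrightarrow> lin_on sU fscale U (\<lambda>u. F u x y)\<rbrakk>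
    \<Longrightarrow> lin_on sU (fscale :: 'k \<Rightarrow> ('c \<Rightarrow> 'k) \<Rightarrow> 'c \<Rightarrow> 'k) U (\<lambda>u. dual_sweedler \<beta> (F u))"
  unfolding dual_sweedler_def by (rule lin_on_tensor_lift_fun[OF dual_comult_in vector_space_fscale])

lemma lin_on_dual_sweedler_id:
  "bilin_on fscale fscale fscale fdual fdual F \<Longrightarrow> lin_on fscale fscale fdual (\<lambda>\<beta>. dual_sweedler \<beta> F)"
  by (rule lin_on_dual_sweedler) simp

lemma dual_sweedler_cong:
  assumes "\<beta> \<in> fdual" "\<And>x y. \<lbrakk>x \<in> fdual; y \<in> fdual\<rbrakk> \<Longrightarrow> F x y = G x y"
  shows "dual_sweedler \<beta> F = dual_sweedler \<beta> G"
  unfolding dual_sweedler_def by (rule tensor_lift_cong[OF dual_comult_in]) (use assms in auto)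

lemma dual_sweedler_hom:
  "(\<And>x y. h (x + y) = h x + h y) \<Longrightarrow> h (dual_sweedler \<beta> F) = dual_sweedler \<beta> (\<lambda>x y. h (F x y))"
  unfolding dual_sweedler_def by (rule tensor_lift_hom)

lemma dual_sweedler_lin:
  "lin_on sV sW UNIV h \<Longrightarrow> h (dual_sweedler \<beta> F) = dual_sweedler \<beta> (\<lambda>x y. h (F x y))"
  by (rule dual_sweedler_hom) (simp add: lin_on_def)

lemma dual_sweedler_apply: "dual_sweedler \<beta> F z = dual_sweedler \<beta> (\<lambda>x y. F x y z)"
  unfolding dual_sweedler_def by (rule tensor_lift_apply)

lemma lin_on_acts_right_left:
  assumes "functional \<sigma>" "lin_on sU scale U g"
  shows "lin_on sU scale U (\<lambda>u. g u \<leftharpoonup> \<sigma>)"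
proof -
  have "lin_on scale scale UNIV (\<lambda>e. e \<leftharpoonup> \<sigma>)"
    unfolding dual_acts_right_def
    by (intro lin_on_sweedler vector_space_axioms bilin_onI lin_onI)
      (simp_all add: functional_add functional_scale assms(1) lin_simps mult.commute)
  from lin_on_compose[OF this assms(2)] show ?thesis by simp
qed

lemma lin_on_acts_right_right: "lin_on sU fscale U g \<Longrightarrow> lin_on sU scale U (\<lambda>u. e \<leftharpoonup> g u)"
proof -
  assume g: "lin_on sU fscale U g"
  have "e \<leftharpoonup> (\<sigma> + \<tau>) = (e \<leftharpoonup> \<sigma>) + (e \<leftharpoonup> \<tau>)" for \<sigma> \<tau>
    using sweedler_add_fun[of e "\<lambda>x y. scale (\<sigma> x) y" "\<lambda>x y. scale (\<tau> x) y"]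
    by (simp add: dual_acts_right_def fun_simps scale_left_distrib[abs_def])
  moreover have "e \<leftharpoonup> fscale c \<sigma> = scale c (e \<leftharpoonup> \<sigma>)" for c \<sigma>
    using sweedler_scale_fun[OF vector_space_axioms, of e c "\<lambda>x y. scale (\<sigma> x) y"]
    by (simp add: dual_acts_right_def fun_simps)
  ultimately show ?thesis
    using g by (simp add: lin_on_def)
qed

text \<open>Rules that prove linearity of a Sweedler expression by descending through its outermost
  operation; they discharge the linearity hypotheses of the coassociativity lemmas.\<close>

lemmas lin_intros = bilin_onI lin_on_id lin_on_fscale_right lin_on_fscale_left lin_on_coantipode_inv
  lin_on_translate lin_on_translate_left lin_on_dual_mult_left lin_on_dual_mult_right
  lin_on_smash_left lin_on_smash_right lin_on_mult_left lin_on_mult_right lin_on_antipode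
  lin_on_sweedler_fun[OF vector_space_fscale] lin_on_sweedler_arg lin_on_dual_sweedler_fun
  lin_on_dual_sweedler_id lin_on_acts_right_left lin_on_acts_right_right

section \<open>Product, action and coaction on simple tensors\<close>

definition heisenberg_term where
  "heisenberg_term \<alpha> a \<beta> b = sweedler a (\<lambda>a' a''. (\<alpha> \<star> translate a' \<beta>) \<sharp> (a'' * b))"

text \<open>The action with \<open>translate\<close> and \<open>coantipode_inv\<close> in place of
  the originals. \<open>dual_sweedler3\<close> and \<open>sweedler3\<close> are written out so that
  the inner coproducts can be regrouped.\<close>

definition action_term where
  "action_term \<mu> m \<alpha> a =
    dual_sweedler \<mu> (\<lambda>\<nu> \<mu>3. dual_sweedler \<nu> (\<lambda>\<mu>1 \<mu>2. sweedler m (\<lambda>l m3. sweedler l (\<lambda>m1 m2.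
      (\<mu>3 \<star> translate m1 \<alpha> \<star> coantipode_inv \<mu>2) \<sharp> ((m2 * a * antipode m3) \<leftharpoonup> coantipode_inv \<mu>1)))))"

lemma lin_on_heisenberg_term:
  shows "lin_on fscale fscale fdual (\<lambda>\<alpha>. heisenberg_term \<alpha> a \<beta> b)"
    and "functional \<beta> \<Longrightarrow> lin_on scale fscale UNIV (\<lambda>a. heisenberg_term \<alpha> a \<beta> b)"
    and "lin_on fscale fscale fdual (\<lambda>\<beta>. heisenberg_term \<alpha> a \<beta> b)"
    and "lin_on scale fscale UNIV (\<lambda>b. heisenberg_term \<alpha> a \<beta> b)"
  unfolding heisenberg_term_def by (intro lin_intros | assumption)+

lemma lin_on_action_term:
  shows "lin_on fscale fscale fdual (\<lambda>\<mu>. action_term \<mu> m \<alpha> a)"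
    and "\<lbrakk>\<mu> \<in> fdual; \<alpha> \<in> fdual\<rbrakk> \<Longrightarrow> lin_on scale fscale UNIV (\<lambda>m. action_term \<mu> m \<alpha> a)"
    and "\<mu> \<in> fdual \<Longrightarrow> lin_on fscale fscale fdual (\<lambda>\<alpha>. action_term \<mu> m \<alpha> a)"
    and "\<mu> \<in> fdual \<Longrightarrow> lin_on scale fscale UNIV (\<lambda>a. action_term \<mu> m \<alpha> a)"
  unfolding action_term_def
  by (intro lin_intros functional_fdual coantipode_inv_fdual | assumption)+

lemma double_lift_cong:
  assumes "x \<in> double_space" "\<And>\<alpha> a. \<alpha> \<in> fdual \<Longrightarrow> F \<alpha> a = G \<alpha> a"
  shows "double_lift x F = double_lift x G"
  unfolding double_lift_def
  by (rule tensor_lift_cong[OF assms(1)[unfolded double_space_def]]) (rule assms(2))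

lemma heisenberg_mult_eq:
  assumes "y \<in> double_space"
  shows "heisenberg_mult x y = double_lift x (\<lambda>\<alpha> a. double_lift y (\<lambda>\<beta> b. heisenberg_term \<alpha> a \<beta> b))"
proof -
  have "double_lift y (\<lambda>\<beta> b. sweedler a (\<lambda>a' a''. (\<alpha> \<star> (a' \<rightharpoonup> \<beta>)) \<sharp> (a'' * b))) =
      double_lift y (\<lambda>\<beta> b. heisenberg_term \<alpha> a \<beta> b)" for \<alpha> a
    by (rule double_lift_cong[OF assms]) (simp add: heisenberg_term_def act_on_dual_translate)
  then show ?thesis
    by (simp add: heisenberg_mult_def)
qed

lemma drinfeld_action_eq:
  assumes "d \<in> double_space" "x \<in> double_space"
  shows "drinfeld_action d x = double_lift d (\<lambda>\<mu> m. double_lift x (\<lambda>\<alpha> a. action_term \<mu> m \<alpha> a))"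
  unfolding drinfeld_action_def
proof (intro double_lift_cong assms)
  fix \<mu> m \<alpha> a assume "\<mu> \<in> fdual" "\<alpha> \<in> fdual"
  then show "dual_sweedler3 \<mu> (\<lambda>\<mu>' \<mu>'' \<mu>'''. sweedler3 m (\<lambda>m' m'' m'''.
        (\<mu>''' \<star> (m' \<rightharpoonup> \<alpha>) \<star> dual_antipode_inv \<mu>'') \<sharp>
        ((m'' * a * antipode m''') \<leftharpoonup> dual_antipode_inv \<mu>'))) = action_term \<mu> m \<alpha> a"
    unfolding dual_sweedler3_def sweedler3_def action_term_def
    by (intro dual_sweedler_cong) (simp_all add: act_on_dual_translate dual_antipode_inv_eq)
qed

lemma smash_double_space: "\<alpha> \<in> fdual \<Longrightarrow> \<alpha> \<sharp> a \<in> double_space"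
  unfolding smash_def double_space_def by (rule double.pure_in_tensor_space) auto

lemma lin_on_double_lift:
  "bilin_on fscale scale fscale fdual UNIV F \<Longrightarrow> lin_on fscale fscale double_space (\<lambda>x. double_lift x F)"
  unfolding double_lift_def double_space_def by (rule double.lin_on_tensor_lift) simp

lemma lin_on_double_lift_fun:
  "\<lbrakk>x \<in> double_space; \<And>\<alpha> a. \<alpha> \<in> fdual \<Longrightarrow> lin_on sU fscale U (\<lambda>u. F u \<alpha> a)\<rbrakk>
    \<Longrightarrow> lin_on sU (fscale :: 'k \<Rightarrow> ('c \<Rightarrow> 'k) \<Rightarrow> 'c \<Rightarrow> 'k) U (\<lambda>u. double_lift x (F u))"
  unfolding double_lift_def double_space_def
  by (rule lin_on_tensor_lift_fun[OF _ vector_space_fscale]) auto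

lemma lin_on_double_eqI:
  fixes g h :: "('k, 'b) double \<Rightarrow> 'c \<Rightarrow> 'k"
  assumes "lin_on fscale fscale double_space g" "lin_on fscale fscale double_space h"
    "\<And>\<alpha> a. \<alpha> \<in> fdual \<Longrightarrow> g (\<alpha> \<sharp> a) = h (\<alpha> \<sharp> a)" "x \<in> double_space"
  shows "g x = h x"
  using assms unfolding smash_def double_space_def
  by (intro double.lin_on_tensor_eqI[OF vector_space_fscale, of g h x])

lemma double_lift_smash:
  "\<lbrakk>bilin_on fscale scale fscale fdual UNIV F; \<alpha> \<in> fdual\<rbrakk>
    \<Longrightarrow> double_lift (\<alpha> \<sharp> a) F = (F \<alpha> a :: 'c \<Rightarrow> 'k)"
  unfolding double_lift_def smash_def by (rule double.tensor_lift_pure[OF vector_space_fscale]) auto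

lemma bilin_heisenberg_term: "bilin_on fscale scale fscale fdual UNIV (heisenberg_term \<alpha> a)"
  by (intro bilin_onI lin_on_heisenberg_term)

lemma bilin_heisenberg_term_left:
  "functional \<beta> \<Longrightarrow> bilin_on fscale scale fscale fdual UNIV (\<lambda>\<alpha> a. heisenberg_term \<alpha> a \<beta> b)"
  by (intro bilin_onI lin_on_heisenberg_term)

lemma bilin_heisenberg_lift:
  "y \<in> double_space \<Longrightarrow>
    bilin_on fscale scale fscale fdual UNIV (\<lambda>\<alpha> a. double_lift y (\<lambda>\<beta> b. heisenberg_term \<alpha> a \<beta> b))"
  by (intro bilin_onI lin_on_double_lift_fun lin_on_heisenberg_term functional_fdual)

lemma lin_on_heisenberg_mult_left:
  "y \<in> double_space \<Longrightarrow> lin_on fscale fscale double_space (\<lambda>x. heisenberg_mult x y)"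
  by (simp add: heisenberg_mult_eq lin_on_double_lift bilin_heisenberg_lift)

lemma lin_on_heisenberg_mult_right:
  assumes "x \<in> double_space"
  shows "lin_on fscale fscale double_space (\<lambda>y. heisenberg_mult x y)"
proof (rule lin_on_cong[OF subspace_double_space vector_space_fscale heisenberg_mult_eq])
  show "lin_on fscale fscale double_space
      (\<lambda>y. double_lift x (\<lambda>\<alpha> a. double_lift y (\<lambda>\<beta> b. heisenberg_term \<alpha> a \<beta> b)))"
    by (intro lin_on_double_lift_fun lin_on_double_lift bilin_heisenberg_term assms)
qed

lemma heisenberg_mult_smash:
  assumes "\<alpha> \<in> fdual" "\<beta> \<in> fdual"
  shows "heisenberg_mult (\<alpha> \<sharp> a) (\<beta> \<sharp> b) = heisenberg_term \<alpha> a \<beta> b"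
  using assms smash_double_space[OF assms(2)]
  by (simp add: heisenberg_mult_eq double_lift_smash bilin_heisenberg_term bilin_heisenberg_term_left
      functional_fdual)

lemma bilin_action_term: "\<mu> \<in> fdual \<Longrightarrow> bilin_on fscale scale fscale fdual UNIV (action_term \<mu> m)"
  by (intro bilin_onI lin_on_action_term)

lemma bilin_action_lift:
  "x \<in> double_space \<Longrightarrow>
    bilin_on fscale scale fscale fdual UNIV (\<lambda>\<mu> m. double_lift x (\<lambda>\<alpha> a. action_term \<mu> m \<alpha> a))"
  by (intro bilin_onI lin_on_double_lift_fun lin_on_action_term)

lemma lin_on_drinfeld_action_left:
  assumes "x \<in> double_space"
  shows "lin_on fscale fscale double_space (\<lambda>d. drinfeld_action d x)"
  by (rule lin_on_cong[OF subspace_double_space vector_space_fscale drinfeld_action_eq[OF _ assms]])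
    (assumption | intro lin_on_double_lift bilin_action_lift assms)+

lemma lin_on_drinfeld_action_right:
  assumes "d \<in> double_space"
  shows "lin_on fscale fscale double_space (\<lambda>x. drinfeld_action d x)"
  by (rule lin_on_cong[OF subspace_double_space vector_space_fscale drinfeld_action_eq[OF assms]])
    (assumption | intro lin_on_double_lift_fun lin_on_double_lift bilin_action_term assms)+

lemma drinfeld_action_smash:
  assumes "\<mu> \<in> fdual" "\<alpha> \<in> fdual"
  shows "drinfeld_action (\<mu> \<sharp> m) (\<alpha> \<sharp> a) = action_term \<mu> m \<alpha> a"
proof -
  have "drinfeld_action (\<mu> \<sharp> m) (\<alpha> \<sharp> a) =
      double_lift (\<mu> \<sharp> m) (\<lambda>\<mu> m. double_lift (\<alpha> \<sharp> a) (\<lambda>\<alpha> a. action_term \<mu> m \<alpha> a))"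
    by (intro drinfeld_action_eq smash_double_space assms)
  also have "\<dots> = double_lift (\<alpha> \<sharp> a) (\<lambda>\<alpha> a. action_term \<mu> m \<alpha> a)"
    by (intro double_lift_smash bilin_action_lift smash_double_space assms)
  also have "\<dots> = action_term \<mu> m \<alpha> a"
    by (intro double_lift_smash bilin_action_term assms)
  finally show ?thesis .
qed

lemma sweedler_mem:
  "\<lbrakk>module.subspace sW W; vector_space sW; \<And>x y. F x y \<in> W\<rbrakk> \<Longrightarrow> sweedler b F \<in> W"
  unfolding sweedler_def by (rule tensor_lift_mem[OF _ _ comult_in])

lemma dual_sweedler_mem:
  "\<lbrakk>module.subspace sW W; vector_space sW; \<beta> \<in> fdual; \<And>x y. \<lbrakk>x \<in> fdual; y \<in> fdual\<rbrakk> \<Longrightarrow> F x y \<in> W\<rbrakk>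
    \<Longrightarrow> dual_sweedler \<beta> F \<in> W"
  unfolding dual_sweedler_def by (rule tensor_lift_mem[OF _ _ dual_comult_in])

lemma action_term_mem: "\<lbrakk>\<mu> \<in> fdual; \<alpha> \<in> fdual\<rbrakk> \<Longrightarrow> action_term \<mu> m \<alpha> a \<in> double_space"
  unfolding action_term_def
  by (intro dual_sweedler_mem[OF subspace_double_space vector_space_fscale]
      sweedler_mem[OF subspace_double_space vector_space_fscale] smash_double_space dual_mult_fdual
      translate_fdual coantipode_inv_fdual)

lemma drinfeld_action_mem:
  assumes "d \<in> double_space" "x \<in> double_space"
  shows "drinfeld_action d x \<in> double_space"
proof -
  have "double_lift x (\<lambda>\<alpha> a. action_term \<mu> m \<alpha> a) \<in> double_space" if "\<mu> \<in> fdual" for \<mu> m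
    unfolding double_lift_def
    by (rule tensor_lift_mem[OF subspace_double_space vector_space_fscale assms(2)[unfolded double_space_def]])
      (rule action_term_mem[OF that])
  then show ?thesis
    unfolding drinfeld_action_eq[OF assms] double_lift_def
    by (intro tensor_lift_mem[OF subspace_double_space vector_space_fscale assms(1)[unfolded double_space_def]])
qed

definition coaction_term where
  "coaction_term \<beta> b = dual_sweedler \<beta> (\<lambda>\<beta>' \<beta>''. sweedler b (\<lambda>b' b''.
    pure_tensor fscale fscale (\<beta>'' \<sharp> b') (\<beta>' \<sharp> b'')))"

lemma lin_on_pure_tensor_left:
    "lin_on sU fscale U g \<Longrightarrow> lin_on sU fscale U (\<lambda>u. pure_tensor fscale fscale (g u :: ('k, 'b) double) (y :: ('k, 'b) double))"
  and lin_on_pure_tensor_right: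
    "lin_on sU fscale U g \<Longrightarrow> lin_on sU fscale U (\<lambda>u. pure_tensor fscale fscale (y :: ('k, 'b) double) (g u :: ('k, 'b) double))"
  by (auto simp: lin_on_def double2.pure_tensor_add_left double2.pure_tensor_add_right
      double2.pure_tensor_scale_left double2.pure_tensor_scale_right)

lemma bilin_coaction_term: "bilin_on fscale scale fscale fdual UNIV coaction_term"
  unfolding coaction_term_def
  by (intro lin_intros lin_on_pure_tensor_left lin_on_pure_tensor_right | assumption)+

lemma drinfeld_coaction_eq: "drinfeld_coaction y = double_lift y coaction_term"
  unfolding drinfeld_coaction_def coaction_term_def ..

lemma coaction_term_mem: "\<beta> \<in> fdual \<Longrightarrow> coaction_term \<beta> b \<in> tensor_space fscale fscale double_space double_space"
  unfolding coaction_term_def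
  by (intro dual_sweedler_mem[OF double2.subspace_tensor_space vector_space_fscale]
      sweedler_mem[OF double2.subspace_tensor_space vector_space_fscale] double2.pure_in_tensor_space
      smash_double_space)

lemma drinfeld_coaction_mem:
  assumes "y \<in> double_space"
  shows "drinfeld_coaction y \<in> tensor_space fscale fscale double_space double_space"
  unfolding drinfeld_coaction_eq double_lift_def
  by (rule tensor_lift_mem[OF double2.subspace_tensor_space vector_space_fscale
        assms[unfolded double_space_def] coaction_term_mem])

text \<open>
  The cancellations on the dual side: the factor \<open>S\<^sup>*\<^sup>-\<^sup>1(\<mu>')\<close>, paired with the coproduct of \<open>e\<close>, cancels
  against \<open>\<beta>'\<close> acted upon by \<open>e\<close>, and then \<open>S\<^sup>*\<^sup>-\<^sup>1(\<mu>'')\<close> cancels against what is left of \<open>\<beta>'\<close>.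
\<close>

lemma dual_cancel_translate:
  assumes \<gamma>: "\<gamma> \<in> fdual"
  shows "dual_sweedler \<gamma> (\<lambda>\<beta>1 \<beta>2. sweedler e (\<lambda>e1 r. fscale (coantipode_inv \<beta>2 e1) (heisenberg_term A r \<beta>1 n))) =
    (A \<star> \<gamma>) \<sharp> (e * n)"
proof -
  define K where "K = (\<lambda>x y. (A \<star> translate x \<gamma>) \<sharp> (y * n))"
  have fn: "functional \<gamma>" by (rule functional_fdual[OF \<gamma>])
  have K1: "lin_on scale fscale UNIV (\<lambda>x. K x y)" and K2: "lin_on scale fscale UNIV (\<lambda>y. K x y)" for x y
    unfolding K_def by (intro lin_intros fn)+
  \<comment> \<open>Evaluated at \<open>x\<close>, the components of \<open>\<gamma>\<close> are
    paired with \<open>x * e2\<close> and \<open>antipode_inv e1\<close>, so they recombine to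
    \<open>\<gamma> (x * e2 * antipode_inv e1)\<close>.\<close>
  have eval: "dual_sweedler \<gamma> (\<lambda>\<beta>1 \<beta>2. fscale (coantipode_inv \<beta>2 e1) ((A \<star> translate e2 \<beta>1) \<sharp> (e3 * n))) =
      K (e2 * antipode_inv e1) e3" for e1 e2 e3
  proof -
    have "dual_sweedler \<gamma> (\<lambda>\<beta>1 \<beta>2. fscale (coantipode_inv \<beta>2 e1) (translate e2 \<beta>1)) = translate (e2 * antipode_inv e1) \<gamma>"
    proof
      fix x
      show "dual_sweedler \<gamma> (\<lambda>\<beta>1 \<beta>2. fscale (coantipode_inv \<beta>2 e1) (translate e2 \<beta>1)) x =
          translate (e2 * antipode_inv e1) \<gamma> x"
        using dual_sweedler_mult[OF \<gamma>, of "x * e2" "antipode_inv e1"]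
        by (simp add: dual_sweedler_apply fscale_apply coantipode_inv_def translate_def mult.commute mult.assoc)
    qed
    moreover have h: "lin_on fscale fscale UNIV (\<lambda>\<phi>. (A \<star> \<phi>) \<sharp> (e3 * n))"
      by (intro lin_intros)
    ultimately show ?thesis
      using dual_sweedler_lin[OF h, of \<gamma> "\<lambda>\<beta>1 \<beta>2. fscale (coantipode_inv \<beta>2 e1) (translate e2 \<beta>1)"]
      by (simp add: K_def lin_on_scale[OF h])
  qed
  have "dual_sweedler \<gamma> (\<lambda>\<beta>1 \<beta>2. sweedler e (\<lambda>e1 r. fscale (coantipode_inv \<beta>2 e1) (heisenberg_term A r \<beta>1 n))) =
      sweedler e (\<lambda>e1 r. sweedler r (\<lambda>e2 e3. K (e2 * antipode_inv e1) e3))"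
    by (simp add: heisenberg_term_def sweedler_scale_fun[OF vector_space_fscale, symmetric]
        sweedler_dual_swap[symmetric] eval)
  \<comment> \<open>After regrouping, \<open>e1\<close> and \<open>e2\<close> are the components of
    \<open>r\<close>, in the order that \<open>sweedler_antipode_inv\<close> removes.\<close>
  also have "\<dots> = sweedler e (\<lambda>r e3. sweedler r (\<lambda>e1 e2. K (e2 * antipode_inv e1) e3))"
  proof (rule sweedler_coassoc[OF vector_space_fscale, symmetric])
    have "lin (\<lambda>u. v * antipode_inv u)" for v
      by (rule lin_on_mult_right[OF lin_antipode_inv])
    from lin_on_compose[OF K1 this]
    show "lin_on scale fscale UNIV (\<lambda>u. K (v * antipode_inv u) w)" for v w by simp
    have "lin (\<lambda>v. v * antipode_inv u)" for u
      by (intro lin_intros)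
    from lin_on_compose[OF K1 this]
    show "lin_on scale fscale UNIV (\<lambda>v. K (v * antipode_inv u) w)" for u w by simp
  qed (rule K2)
  also have "\<dots> = sweedler e (\<lambda>r e3. fscale (counit r) (K 1 e3))"
    by (simp add: sweedler_antipode_inv[OF K1])
  also have "\<dots> = K 1 e"
    by (rule sweedler_counit_left[OF K2])
  finally show ?thesis
    by (simp add: K_def translate_1)
qed

text \<open>At \<open>x\<close> the sum becomes one over
  \<open>\<rho> (x2 * antipode_inv x1)\<close>, so this is the law for the inverse antipode of B
  read in the dual.\<close>

lemma dual_cancel_antipode:
  assumes \<rho>: "\<rho> \<in> fdual"
  shows "dual_sweedler \<rho> (\<lambda>\<gamma> \<beta>3. coantipode_inv \<beta>3 \<star> \<gamma>) = fscale (\<rho> 1) counit"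
proof
  fix x
  have "dual_sweedler \<rho> (\<lambda>\<gamma> \<beta>3. coantipode_inv \<beta>3 \<star> \<gamma>) x =
      sweedler x (\<lambda>x1 x2. dual_sweedler \<rho> (\<lambda>\<gamma> \<beta>3. \<gamma> x2 * \<beta>3 (antipode_inv x1)))"
    by (simp add: dual_sweedler_apply dual_mult_def coantipode_inv_def sweedler_dual_swap mult.commute)
  also have "\<dots> = sweedler x (\<lambda>x1 x2. \<rho> (x2 * antipode_inv x1))"
    by (simp add: dual_sweedler_mult[OF \<rho>])
  also have "\<dots> = counit x * \<rho> 1"
    by (rule sweedler_antipode_inv[OF functional_fdual[OF \<rho>]])
  finally show "dual_sweedler \<rho> (\<lambda>\<gamma> \<beta>3. coantipode_inv \<beta>3 \<star> \<gamma>) x = fscale (\<rho> 1) counit x"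
    by (simp add: fscale_apply)
qed

text \<open>\<open>\<beta>1\<close> is the dual component in \<open>y\<^sub>0\<close>, while
  \<open>\<beta>2\<close>, \<open>\<beta>3\<close>, \<open>\<beta>4\<close> are those of the acting
  element; \<open>\<psi>\<close> stands for \<open>translate m1 \<alpha>\<close> and
  \<open>e\<close> for \<open>m2 * a * antipode m3\<close>. Coassociativity, used twice, brings
  \<open>\<beta>1\<close> next to \<open>\<beta>2\<close> and what they leave next to
  \<open>\<beta>3\<close>, where the two preceding lemmas apply.\<close>

lemma dual_cancel:
  assumes \<beta>: "\<beta> \<in> fdual" and \<psi>: "functional \<psi>"
  shows "dual_sweedler \<beta> (\<lambda>\<beta>1 \<mu>. dual_sweedler \<mu> (\<lambda>\<nu> \<beta>4. dual_sweedler \<nu> (\<lambda>\<beta>2 \<beta>3.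
      sweedler e (\<lambda>e1 r. fscale (coantipode_inv \<beta>2 e1)
        (heisenberg_term (\<beta>4 \<star> \<psi> \<star> coantipode_inv \<beta>3) r \<beta>1 n))))) = (\<beta> \<star> \<psi>) \<sharp> (e * n)"
proof -
  define T where "T = (\<lambda>\<beta>1 \<beta>2 \<beta>3 \<beta>4. sweedler e (\<lambda>e1 r. fscale (coantipode_inv \<beta>2 e1)
        (heisenberg_term (\<beta>4 \<star> \<psi> \<star> coantipode_inv \<beta>3) r \<beta>1 n)))"
  have T1: "lin_on fscale fscale fdual (\<lambda>\<beta>1. T \<beta>1 \<beta>2 \<beta>3 \<beta>4)"
    and T2: "lin_on fscale fscale fdual (\<lambda>\<beta>2. T \<beta>1 \<beta>2 \<beta>3 \<beta>4)"
    and T3: "lin_on fscale fscale fdual (\<lambda>\<beta>3. T \<beta>1 \<beta>2 \<beta>3 \<beta>4)"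
    and T4: "lin_on fscale fscale fdual (\<lambda>\<beta>4. T \<beta>1 \<beta>2 \<beta>3 \<beta>4)" for \<beta>1 \<beta>2 \<beta>3 \<beta>4
  proof -
    have "lin_on fscale (*) fdual (\<lambda>\<beta>2. coantipode_inv \<beta>2 e1)" for e1
      unfolding coantipode_inv_def by (rule lin_on_eval)
    then show "lin_on fscale fscale fdual (\<lambda>\<beta>2. T \<beta>1 \<beta>2 \<beta>3 \<beta>4)"
      unfolding T_def by (intro lin_intros)
  qed (unfold T_def heisenberg_term_def, (intro lin_intros)+)
  have "dual_sweedler \<beta> (\<lambda>\<beta>1 \<mu>. dual_sweedler \<mu> (\<lambda>\<nu> \<beta>4. dual_sweedler \<nu> (\<lambda>\<beta>2 \<beta>3. T \<beta>1 \<beta>2 \<beta>3 \<beta>4))) =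
      dual_sweedler \<beta> (\<lambda>\<rho> \<beta>4. dual_sweedler \<rho> (\<lambda>\<beta>1 \<nu>. dual_sweedler \<nu> (\<lambda>\<beta>2 \<beta>3. T \<beta>1 \<beta>2 \<beta>3 \<beta>4)))"
    by (rule dual_coassoc[OF \<beta> vector_space_fscale, symmetric]) (intro lin_intros T1 T2 T3 T4 | assumption)+
  also have "\<dots> = dual_sweedler \<beta> (\<lambda>\<rho> \<beta>4. dual_sweedler \<rho> (\<lambda>\<gamma> \<beta>3. dual_sweedler \<gamma> (\<lambda>\<beta>1 \<beta>2. T \<beta>1 \<beta>2 \<beta>3 \<beta>4)))"
    by (intro dual_sweedler_cong[OF \<beta>] dual_coassoc[OF _ vector_space_fscale T1 T2 T3, symmetric])
  also have "\<dots> = dual_sweedler \<beta> (\<lambda>\<rho> \<beta>4. fscale (\<rho> 1) ((\<beta>4 \<star> \<psi>) \<sharp> (e * n)))"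
  proof (rule dual_sweedler_cong[OF \<beta>])
    fix \<rho> \<beta>4 assume \<rho>: "\<rho> \<in> fdual" and \<beta>4: "\<beta>4 \<in> fdual"
    have fn: "functional (\<beta>4 \<star> \<psi>)"
      by (intro functional_dual_mult functional_fdual \<beta>4 \<psi>)
    have h: "lin_on fscale fscale UNIV (\<lambda>\<phi>. (\<beta>4 \<star> \<psi> \<star> \<phi>) \<sharp> (e * n))"
      by (intro lin_intros)
    have "dual_sweedler \<rho> (\<lambda>\<gamma> \<beta>3. dual_sweedler \<gamma> (\<lambda>\<beta>1 \<beta>2. T \<beta>1 \<beta>2 \<beta>3 \<beta>4)) =
        dual_sweedler \<rho> (\<lambda>\<gamma> \<beta>3. (\<beta>4 \<star> \<psi> \<star> (coantipode_inv \<beta>3 \<star> \<gamma>)) \<sharp> (e * n))"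
      by (intro dual_sweedler_cong[OF \<rho>])
        (simp add: T_def dual_cancel_translate dual_mult_assoc fn functional_fdual coantipode_inv_fdual)
    also have "\<dots> = (\<beta>4 \<star> \<psi> \<star> fscale (\<rho> 1) counit) \<sharp> (e * n)"
      by (simp only: dual_sweedler_lin[OF h, symmetric] dual_cancel_antipode[OF \<rho>])
    also have "\<dots> = fscale (\<rho> 1) ((\<beta>4 \<star> \<psi>) \<sharp> (e * n))"
      using lin_on_scale[OF h UNIV_I, of "\<rho> 1" counit] by (simp add: dual_mult_counit_right fn)
    finally show "dual_sweedler \<rho> (\<lambda>\<gamma> \<beta>3. dual_sweedler \<gamma> (\<lambda>\<beta>1 \<beta>2. T \<beta>1 \<beta>2 \<beta>3 \<beta>4)) =
        fscale (\<rho> 1) ((\<beta>4 \<star> \<psi>) \<sharp> (e * n))" .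
  qed
  also have "\<dots> = (\<beta> \<star> \<psi>) \<sharp> (e * n)"
  proof -
    have h: "lin_on fscale fscale UNIV (\<lambda>\<phi>. (\<phi> \<star> \<psi>) \<sharp> (e * n))"
      by (intro lin_intros)
    \<comment> \<open>Counit law of the finite dual, whose counit is evaluation at 1.\<close>
    have "dual_sweedler \<beta> (\<lambda>\<rho> \<beta>4. fscale (\<rho> 1) \<beta>4) = \<beta>"
      using dual_sweedler_mult[OF \<beta>, of 1] by (simp add: fun_eq_iff dual_sweedler_apply fscale_apply)
    then show ?thesis
      using dual_sweedler_lin[OF h, of \<beta> "\<lambda>\<rho> \<beta>4. fscale (\<rho> 1) \<beta>4"] by (simp add: lin_on_scale[OF h])
  qed
  finally show ?thesis
    by (simp add: T_def)
qed

text \<open>The components of \<open>b\<close> are \<open>m1\<close>, \<open>m2\<close>,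
  \<open>m3\<close>, \<open>n\<close>. Coassociativity splits \<open>m3\<close> and \<open>n\<close>
  off together, the left antipode law removes them, and what remains is the product of simple
  tensors.\<close>

lemma algebra_cancel:
  assumes \<alpha>: "functional \<alpha>"
  shows "sweedler b (\<lambda>b1 n. sweedler b1 (\<lambda>l m3. sweedler l (\<lambda>m1 m2.
      (\<beta> \<star> translate m1 \<alpha>) \<sharp> (m2 * a * antipode m3 * n)))) = heisenberg_term \<beta> b \<alpha> a"
proof -
  define H where "H = (\<lambda>l z. sweedler l (\<lambda>m1 m2. (\<beta> \<star> translate m1 \<alpha>) \<sharp> (m2 * a * z)))"
  have H1: "lin_on scale fscale UNIV (\<lambda>l. H l z)" and H2: "lin_on scale fscale UNIV (\<lambda>z. H l z)" for l z
    unfolding H_def by (intro lin_intros \<alpha>)+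
  have H3: "lin_on scale fscale UNIV (\<lambda>u. H l (antipode u * v))" "lin_on scale fscale UNIV (\<lambda>v. H l (antipode u * v))"
    for l u v
    unfolding H_def by (intro lin_intros)+
  have "sweedler b (\<lambda>b1 n. sweedler b1 (\<lambda>l m3. sweedler l (\<lambda>m1 m2.
      (\<beta> \<star> translate m1 \<alpha>) \<sharp> (m2 * a * antipode m3 * n)))) =
      sweedler b (\<lambda>b1 n. sweedler b1 (\<lambda>l m3. H l (antipode m3 * n)))"
    by (simp add: H_def mult.assoc)
  also have "\<dots> = sweedler b (\<lambda>l s. sweedler s (\<lambda>m3 n. H l (antipode m3 * n)))"
    by (rule sweedler_coassoc[OF vector_space_fscale H1 H3])
  also have "\<dots> = sweedler b (\<lambda>l s. fscale (counit s) (H l 1))"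
    by (simp add: sweedler_antipode_left[OF H2])
  also have "\<dots> = H b 1"
    by (rule sweedler_counit_right[OF H1])
  finally show ?thesis
    by (simp add: H_def heisenberg_term_def)
qed

text \<open>Linearity in the algebra argument pulls the pairing with \<open>\<sigma>\<close> out of
  the product. This exposes the components \<open>e1\<close> and \<open>r\<close> on which
  \<open>dual_cancel_translate\<close> works.\<close>

lemma heisenberg_term_acts_right:
  assumes "functional \<beta>"
  shows "heisenberg_term \<alpha> (e \<leftharpoonup> \<sigma>) \<beta> n = sweedler e (\<lambda>e1 r. fscale (\<sigma> e1) (heisenberg_term \<alpha> r \<beta> n))"
  unfolding dual_acts_right_def
  by (simp add: sweedler_lin[OF lin_on_heisenberg_term(2)[OF assms]]
      lin_on_scale[OF lin_on_heisenberg_term(2)[OF assms]])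

text \<open>Multiplication by a fixed element is known to be linear only on
  \<open>double_space\<close>, so it is pulled through the four nested sums one at a time, each time
  checking that the summands lie there.\<close>

lemma heisenberg_mult_action_term:
  assumes \<mu>: "\<mu> \<in> fdual" and \<alpha>: "\<alpha> \<in> fdual" and \<beta>1: "\<beta>1 \<in> fdual"
  shows "heisenberg_mult (action_term \<mu> m \<alpha> a) (\<beta>1 \<sharp> n) =
    dual_sweedler \<mu> (\<lambda>\<nu> \<beta>4. dual_sweedler \<nu> (\<lambda>\<beta>2 \<beta>3. sweedler m (\<lambda>l m3. sweedler l (\<lambda>m1 m2.
      sweedler (m2 * a * antipode m3) (\<lambda>e1 r. fscale (coantipode_inv \<beta>2 e1)
        (heisenberg_term (\<beta>4 \<star> translate m1 \<alpha> \<star> coantipode_inv \<beta>3) r \<beta>1 n))))))"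
proof -
  note h = lin_on_heisenberg_mult_left[OF smash_double_space[OF \<beta>1]]
  note D = subspace_double_space vector_space_fscale
  define s where "s = (\<lambda>\<mu>1 \<mu>2 \<mu>3 l m3. sweedler l (\<lambda>m1 m2.
      (\<mu>3 \<star> translate m1 \<alpha> \<star> coantipode_inv \<mu>2) \<sharp> ((m2 * a * antipode m3) \<leftharpoonup> coantipode_inv \<mu>1)))"
  have pure: "(\<mu>3 \<star> translate m1 \<alpha> \<star> coantipode_inv \<mu>2) \<sharp> c \<in> double_space"
    if "\<mu>3 \<in> fdual" "\<mu>2 \<in> fdual" for \<mu>3 \<mu>2 m1 c
    using that by (intro smash_double_space dual_mult_fdual translate_fdual coantipode_inv_fdual \<alpha>)
  have s: "s \<mu>1 \<mu>2 \<mu>3 l m3 \<in> double_space" if "\<mu>3 \<in> fdual" "\<mu>2 \<in> fdual" for \<mu>1 \<mu>2 \<mu>3 l m3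
    unfolding s_def by (intro sweedler_mem[OF D] pure that)
  have sw: "heisenberg_mult (sweedler c F) (\<beta>1 \<sharp> n) = sweedler c (\<lambda>x y. heisenberg_mult (F x y) (\<beta>1 \<sharp> n))"
    if "\<And>x y. F x y \<in> double_space" for c F
    unfolding sweedler_def by (rule tensor_lift_lin_hom[OF D vector_space_fscale comult_in that h])
  have ds: "heisenberg_mult (dual_sweedler \<nu> F) (\<beta>1 \<sharp> n) = dual_sweedler \<nu> (\<lambda>x y. heisenberg_mult (F x y) (\<beta>1 \<sharp> n))"
    if "\<nu> \<in> fdual" "\<And>x y. \<lbrakk>x \<in> fdual; y \<in> fdual\<rbrakk> \<Longrightarrow> F x y \<in> double_space" for \<nu> F
    unfolding dual_sweedler_def by (rule tensor_lift_lin_hom[OF D vector_space_fscale dual_comult_in[OF that(1)] that(2) h])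
  have hs: "heisenberg_mult (s \<mu>1 \<mu>2 \<mu>3 l m3) (\<beta>1 \<sharp> n) =
      sweedler l (\<lambda>m1 m2. sweedler (m2 * a * antipode m3) (\<lambda>e1 r. fscale (coantipode_inv \<mu>1 e1)
        (heisenberg_term (\<mu>3 \<star> translate m1 \<alpha> \<star> coantipode_inv \<mu>2) r \<beta>1 n)))"
    if "\<mu>3 \<in> fdual" "\<mu>2 \<in> fdual" for \<mu>1 \<mu>2 \<mu>3 l m3
    unfolding s_def sw[OF pure[OF that]]
    by (simp add: heisenberg_mult_smash \<beta>1 dual_mult_fdual translate_fdual coantipode_inv_fdual \<alpha> that
        heisenberg_term_acts_right functional_fdual)
  have "action_term \<mu> m \<alpha> a =
      dual_sweedler \<mu> (\<lambda>\<nu> \<mu>3. dual_sweedler \<nu> (\<lambda>\<mu>1 \<mu>2. sweedler m (s \<mu>1 \<mu>2 \<mu>3)))"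
    by (simp add: action_term_def s_def)
  then have "heisenberg_mult (action_term \<mu> m \<alpha> a) (\<beta>1 \<sharp> n) =
      heisenberg_mult (dual_sweedler \<mu> (\<lambda>\<nu> \<mu>3. dual_sweedler \<nu> (\<lambda>\<mu>1 \<mu>2. sweedler m (s \<mu>1 \<mu>2 \<mu>3)))) (\<beta>1 \<sharp> n)"
    by (rule arg_cong)
  also have "\<dots> = dual_sweedler \<mu> (\<lambda>\<nu> \<mu>3.
      heisenberg_mult (dual_sweedler \<nu> (\<lambda>\<mu>1 \<mu>2. sweedler m (s \<mu>1 \<mu>2 \<mu>3))) (\<beta>1 \<sharp> n))"
    by (rule ds[OF \<mu>]) (intro dual_sweedler_mem[OF D] sweedler_mem[OF D] s)
  also have "\<dots> = dual_sweedler \<mu> (\<lambda>\<nu> \<mu>3. dual_sweedler \<nu> (\<lambda>\<mu>1 \<mu>2.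
      heisenberg_mult (sweedler m (s \<mu>1 \<mu>2 \<mu>3)) (\<beta>1 \<sharp> n)))"
    by (intro dual_sweedler_cong[OF \<mu>] ds sweedler_mem[OF D] s)
  also have "\<dots> = dual_sweedler \<mu> (\<lambda>\<nu> \<mu>3. dual_sweedler \<nu> (\<lambda>\<mu>1 \<mu>2. sweedler m (\<lambda>l m3.
      heisenberg_mult (s \<mu>1 \<mu>2 \<mu>3 l m3) (\<beta>1 \<sharp> n))))"
    by (intro dual_sweedler_cong[OF \<mu>] dual_sweedler_cong sw s)
  also have "\<dots> = dual_sweedler \<mu> (\<lambda>\<nu> \<mu>3. dual_sweedler \<nu> (\<lambda>\<mu>1 \<mu>2. sweedler m (\<lambda>l m3. sweedler l (\<lambda>m1 m2.
      sweedler (m2 * a * antipode m3) (\<lambda>e1 r. fscale (coantipode_inv \<mu>1 e1)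
        (heisenberg_term (\<mu>3 \<star> translate m1 \<alpha> \<star> coantipode_inv \<mu>2) r \<beta>1 n))))))"
    by (rule dual_sweedler_cong[OF \<mu>], rule dual_sweedler_cong, assumption) (simp add: hs)
  finally show ?thesis .
qed

lemma braided_commutative_smash:
  assumes \<alpha>: "\<alpha> \<in> fdual" and \<beta>: "\<beta> \<in> fdual"
  shows "dual_sweedler \<beta> (\<lambda>\<beta>1 \<mu>. sweedler b (\<lambda>b1 n.
      heisenberg_mult (drinfeld_action (\<mu> \<sharp> b1) (\<alpha> \<sharp> a)) (\<beta>1 \<sharp> n))) = heisenberg_mult (\<beta> \<sharp> b) (\<alpha> \<sharp> a)"
proof -
  define T where "T = (\<lambda>\<beta>1 \<beta>2 \<beta>3 \<beta>4 m1 e n. sweedler e (\<lambda>e1 r. fscale (coantipode_inv \<beta>2 e1)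
        (heisenberg_term (\<beta>4 \<star> translate m1 \<alpha> \<star> coantipode_inv \<beta>3) r \<beta>1 n)))"
  have "dual_sweedler \<beta> (\<lambda>\<beta>1 \<mu>. sweedler b (\<lambda>b1 n.
      heisenberg_mult (drinfeld_action (\<mu> \<sharp> b1) (\<alpha> \<sharp> a)) (\<beta>1 \<sharp> n))) =
    dual_sweedler \<beta> (\<lambda>\<beta>1 \<mu>. sweedler b (\<lambda>b1 n. dual_sweedler \<mu> (\<lambda>\<nu> \<beta>4. dual_sweedler \<nu> (\<lambda>\<beta>2 \<beta>3.
      sweedler b1 (\<lambda>l m3. sweedler l (\<lambda>m1 m2. T \<beta>1 \<beta>2 \<beta>3 \<beta>4 m1 (m2 * a * antipode m3) n))))))"
    by (intro dual_sweedler_cong[OF \<beta>]) (simp add: drinfeld_action_smash heisenberg_mult_action_term \<alpha> T_def)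
  \<comment> \<open>The sums over \<open>b\<close> move outside. With \<open>m1\<close>,
    \<open>m2\<close>, \<open>m3\<close>, \<open>n\<close> held fixed, the sums over the components
    of \<open>\<beta>\<close> have the shape required by \<open>dual_cancel\<close>.\<close>
  also have "\<dots> = sweedler b (\<lambda>b1 n. sweedler b1 (\<lambda>l m3. sweedler l (\<lambda>m1 m2.
      dual_sweedler \<beta> (\<lambda>\<beta>1 \<mu>. dual_sweedler \<mu> (\<lambda>\<nu> \<beta>4. dual_sweedler \<nu> (\<lambda>\<beta>2 \<beta>3.
        T \<beta>1 \<beta>2 \<beta>3 \<beta>4 m1 (m2 * a * antipode m3) n))))))"
    by (simp only: sweedler_dual_swap)
  also have "\<dots> = sweedler b (\<lambda>b1 n. sweedler b1 (\<lambda>l m3. sweedler l (\<lambda>m1 m2.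
      (\<beta> \<star> translate m1 \<alpha>) \<sharp> (m2 * a * antipode m3 * n))))"
    by (simp add: T_def dual_cancel[OF \<beta>] functional_fdual translate_fdual \<alpha>)
  also have "\<dots> = heisenberg_mult (\<beta> \<sharp> b) (\<alpha> \<sharp> a)"
    by (simp add: algebra_cancel functional_fdual heisenberg_mult_smash \<alpha> \<beta>)
  finally show ?thesis .
qed

section \<open>Extension from simple tensors by bilinearity\<close>

lemma bilin_braiding:
  assumes "x \<in> double_space"
  shows "bilin_on fscale fscale fscale double_space double_space (\<lambda>d z. heisenberg_mult (drinfeld_action d x) z)"
proof (rule bilin_onI)
  fix z assume "z \<in> double_space"
  from lin_on_compose[OF lin_on_heisenberg_mult_left[OF this] lin_on_drinfeld_action_left[OF assms]]
  show "lin_on fscale fscale double_space (\<lambda>d. heisenberg_mult (drinfeld_action d x) z)"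
    by (simp add: drinfeld_action_mem assms)
qed (intro lin_on_heisenberg_mult_right drinfeld_action_mem assms)

lemma braided_commutative_heisenberg:
  "braided_commutative fscale double_space fscale double_space heisenberg_mult drinfeld_action drinfeld_coaction"
  unfolding braided_commutative_def
proof (intro ballI)
  fix x y assume x: "x \<in> double_space" and y: "y \<in> double_space"
  \<comment> \<open>The braided side of the identity. The lift runs over the coaction of
    \<open>y\<close>, so linearity in \<open>y\<close> needs \<open>bilin_braiding\<close>, whereas
    linearity in \<open>x\<close> holds term by term.\<close>
  define R where "R = (\<lambda>y x. tensor_lift fscale fscale double_space double_space (drinfeld_coaction y)
    (\<lambda>d z. heisenberg_mult (drinfeld_action d x) z))"
  have R_left: "lin_on fscale fscale double_space (\<lambda>y. R y x)" if "x \<in> double_space" for x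
    unfolding R_def drinfeld_coaction_eq
    by (rule lin_on_compose[OF double2.lin_on_tensor_lift[OF vector_space_fscale bilin_braiding[OF that]]
          lin_on_double_lift[OF bilin_coaction_term]])
      (rule drinfeld_coaction_mem[unfolded drinfeld_coaction_eq])
  have R_right: "lin_on fscale fscale double_space (\<lambda>x. R y x)" if "y \<in> double_space" for y
    unfolding R_def
  proof (rule lin_on_tensor_lift_fun[OF drinfeld_coaction_mem[OF that] vector_space_fscale])
    fix d z assume "d \<in> double_space" "z \<in> double_space"
    from lin_on_compose[OF lin_on_heisenberg_mult_left[OF this(2)] lin_on_drinfeld_action_right[OF this(1)]]
    show "lin_on fscale fscale double_space (\<lambda>x. heisenberg_mult (drinfeld_action d x) z)"
      by (simp add: drinfeld_action_mem \<open>d \<in> double_space\<close>)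
  qed
  have R_smash: "R (\<beta> \<sharp> b) (\<alpha> \<sharp> a) = heisenberg_mult (\<beta> \<sharp> b) (\<alpha> \<sharp> a)"
    if \<alpha>: "\<alpha> \<in> fdual" and \<beta>: "\<beta> \<in> fdual" for \<alpha> a \<beta> b
  proof -
    let ?G = "\<lambda>t. tensor_lift fscale fscale double_space double_space t
      (\<lambda>d z. heisenberg_mult (drinfeld_action d (\<alpha> \<sharp> a)) z)"
    note bil = bilin_braiding[OF smash_double_space[OF \<alpha>]]
    note G = double2.lin_on_tensor_lift[OF vector_space_fscale bil]
    note D = double2.subspace_tensor_space vector_space_fscale
    have pure: "pure_tensor fscale fscale (\<mu> \<sharp> c) (\<nu> \<sharp> d) \<in> tensor_space fscale fscale double_space double_space"
      if "\<mu> \<in> fdual" "\<nu> \<in> fdual" for \<mu> \<nu> c d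
      using that by (intro double2.pure_in_tensor_space smash_double_space)
    have inner: "?G (sweedler b (\<lambda>b' b''. pure_tensor fscale fscale (\<beta>'' \<sharp> b') (\<beta>' \<sharp> b''))) =
        sweedler b (\<lambda>b' b''. heisenberg_mult (drinfeld_action (\<beta>'' \<sharp> b') (\<alpha> \<sharp> a)) (\<beta>' \<sharp> b''))"
      if "\<beta>' \<in> fdual" "\<beta>'' \<in> fdual" for \<beta>' \<beta>''
      unfolding sweedler_def
      by (subst tensor_lift_lin_hom[OF D vector_space_fscale comult_in pure[OF that(2,1)] G])
        (simp add: double2.tensor_lift_pure[OF vector_space_fscale bil] smash_double_space that)
    have "R (\<beta> \<sharp> b) (\<alpha> \<sharp> a) = ?G (coaction_term \<beta> b)"
      by (simp add: R_def drinfeld_coaction_eq double_lift_smash[OF bilin_coaction_term \<beta>])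
    also have "\<dots> = dual_sweedler \<beta> (\<lambda>\<beta>' \<beta>''. ?G (sweedler b (\<lambda>b' b''. pure_tensor fscale fscale (\<beta>'' \<sharp> b') (\<beta>' \<sharp> b''))))"
      unfolding coaction_term_def dual_sweedler_def
      by (rule tensor_lift_lin_hom[OF D vector_space_fscale dual_comult_in[OF \<beta>] _ G])
        (intro sweedler_mem[OF D] pure)
    also have "\<dots> = dual_sweedler \<beta> (\<lambda>\<beta>' \<beta>''. sweedler b (\<lambda>b' b''.
        heisenberg_mult (drinfeld_action (\<beta>'' \<sharp> b') (\<alpha> \<sharp> a)) (\<beta>' \<sharp> b'')))"
      by (rule dual_sweedler_cong[OF \<beta> inner])
    also have "\<dots> = heisenberg_mult (\<beta> \<sharp> b) (\<alpha> \<sharp> a)"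
      by (rule braided_commutative_smash[OF \<alpha> \<beta>])
    finally show ?thesis .
  qed
  \<comment> \<open>The extension takes two rounds: in \<open>y\<close> while \<open>x\<close> is
    still a simple tensor, then in \<open>x\<close>.\<close>
  have R_y: "R y (\<alpha> \<sharp> a) = heisenberg_mult y (\<alpha> \<sharp> a)" if "\<alpha> \<in> fdual" for \<alpha> a
    by (rule lin_on_double_eqI[OF R_left lin_on_heisenberg_mult_left R_smash y])
      (intro smash_double_space that)+
  have "R y x = heisenberg_mult y x"
    by (rule lin_on_double_eqI[OF R_right[OF y] lin_on_heisenberg_mult_right[OF y] R_y x])
  then show "heisenberg_mult y x = tensor_lift fscale fscale double_space double_space (drinfeld_coaction y)
      (\<lambda>d z. heisenberg_mult (drinfeld_action d x) z)"
    by (simp add: R_def)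
qed

end

theorem theorem3p2:
  fixes scale :: "'k::field \<Rightarrow> 'b::ring_1 \<Rightarrow> 'b"
    and comult :: "'b \<Rightarrow> ('b, 'b, 'k) tensor"
    and counit :: "'b \<Rightarrow> 'k"
    and antipode :: "'b \<Rightarrow> 'b"
  assumes "hopf_algebra scale comult counit antipode"
    and "bij antipode"
  shows "braided_commutative
    fscale (hopf_algebra.double_space scale)
    fscale (hopf_algebra.double_space scale)
    (hopf_algebra.heisenberg_mult scale comult)
    (hopf_algebra.drinfeld_action scale comult antipode)
    (hopf_algebra.drinfeld_coaction scale comult)"
proof -
  interpret bijective_hopf_algebra scale comult counit antipode
    by (intro bijective_hopf_algebra.intro bijective_hopf_algebra_axioms.intro assms)
  show ?thesis by (rule braided_commutative_heisenberg)
qed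

end
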